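(* Let $T_i=(t_{i1},t_{ia},t_{ib})$, $i=2,3,4$, be three triangles in complex hyperbolic space satisfying the matching side length conditions $$\delta(t_{21},t_{2b})=\delta(t_{31},t_{3a}),\quad \delta(t_{31},t_{3b})=\delta(t_{41},t_{4a}),\quad \delta(t_{41},t_{4b})=\delta(t_{21},t_{2a}).$$ Write $\operatorname{kos}(T_i)=\operatorname{kos}_{t_{i1}}(t_{ia},t_{ib})$ and let $$\mathcal{M}(\{T_i\})=\begin{pmatrix}1&K_{23}&K_{24}\\ \overline{K_{23}}&1&K_{34}\\ \overline{K_{24}}&\overline{K_{34}}&1\end{pmatrix},\qquad K_{23}=\operatorname{kos}(T_2),\ K_{34}=\operatorname{kos}(T_3),\ K_{24}=\overline{\operatorname{kos}(T_4)}.$$ For a tetrahedron $X=(x_1,x_2,x_3,x_4)$ let $\mathcal{M}(X)=(\operatorname{kos}_{x_1}(x_i,x_j))_{i,j=2}^4$, and write $\{T_i\}\rightrightarrows X$ if $T_2$ is congruent to $(x_1,x_2,x_3)$, $T_3$ is congruent to $(x_1,x_3,x_4)$ and $T_4$ is congruent to $(x_1,x_4,x_2)$. Then: (1) If $\{T_i\}\rightrightarrows X$ then $\mathcal{M}(\{T_i\})=\mathcal{M}(X)$ and this matrix is positive semidefinite. (2) If $\mathcal{M}(\{T_i\})$ is positive semidefinite then there is a tetrahedron $X$ in $\mathbb{CH}^m$ for some $m$ with $\{T_i\}\rightrightarrows X$, in which case $\mathcal{M}(\{T_i\})=\mathcal{M}(X)$. (3) The following are equivalent: $\mathcal{M}(\{T_i\})$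 is positive semidefinite; $\det\mathcal{M}(\{T_i\})\ge 0$; $0\le 1+2\operatorname{Re}(K_{23}\overline{K_{24}}K_{34})-|K_{23}|^2-|K_{24}|^2-|K_{34}|^2$; and $$\left|K_{34}-\overline{K_{23}}K_{24}\right|^2\le(1-|K_{23}|^2)(1-|K_{24}|^2).$$
   Context: $\mathbb{CH}^n$ is the open unit ball $\mathbb{B}_n\subset\mathbb{C}^n$ with its group $\operatorname{Aut}\mathbb{B}_n$ of biholomorphic automorphisms, and $\langle\langle z,w\rangle\rangle=\sum_i z_i\overline{w_i}$. For $a\in\mathbb{B}_n$, $\phi_a\in\operatorname{Aut}\mathbb{B}_n$ is the involution interchanging $a$ and $0$: $\phi_a(z)=\dfrac{a-P_az-(1-|a|^2)^{1/2}(z-P_az)}{1-\langle\langle z,a\rangle\rangle}$, where $P_a$ is the orthogonal projection onto the span of $a$ ($P_0=0$). The pseudohyperbolic metric is $\delta(a,b)=|\phi_a(b)|$. For $y,z\neq x$, $\operatorname{kos}_x(y,z)=\left\langle\left\langle \frac{\phi_x(y)}{|\phi_x(y)|},\frac{\phi_x(z)}{|\phi_x(z)|}\right\rangle\right\rangle$. A triangle (tetrahedron) in complex hyperbolic space is an ordered triple (quadruple) of distinct points of some $\mathbb{CH}^n$; no nondegeneracy is required. Two ordered tuples of the same length are congruent if some automorphism takes the $j$-th point of the first to the $j$-th point of the second for every $j$; tuples in balls of different dimensions are first placed in a common ball via the natural inclusions $\mathbb{B}_r\subset\mathbb{B}_{r'}$. Positive semidefinite matrices are understood to be Hermitian. 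*)

theory Defs
  imports "HOL-Complex_Analysis.Complex_Analysis" "Jordan_Normal_Form.Schur_Decomposition"
begin

text \<open>
  Points of \<open>\<complex>\<^sup>n\<close> are elements of \<^term>\<open>carrier_vec n :: complex vec set\<close>, so that the
  dimension can be quantified over inside a statement. The Hermitian product
  \<open>\<Sum>\<^sub>i z\<^sub>i cnj w\<^sub>i\<close> is \<^term>\<open>z \<bullet>c w\<close>, linear in the first argument.
\<close>

definition cvec_norm :: "complex vec \<Rightarrow> real" where
  "cvec_norm z = sqrt (Re (z \<bullet>c z))"

definition unit_ball :: "nat \<Rightarrow> complex vec set" where
  "unit_ball n = {z \<in> carrier_vec n. cvec_norm z < 1}"

text \<open>
  Holomorphic means complex (Frechet) differentiable at every point of the open set \<open>U\<close>. The
  increment \<open>h\<close> need not keep \<open>z + h\<close> inside \<open>U\<close>, but \<open>d\<close> may be chosen small enough for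
  that, so values of \<open>f\<close> outside \<open>U\<close> are irrelevant.
\<close>

definition holomorphic_map_on :: "nat \<Rightarrow> complex vec set \<Rightarrow> (complex vec \<Rightarrow> complex vec) \<Rightarrow> bool" where
  "holomorphic_map_on n U f \<longleftrightarrow> (\<forall>z\<in>U. f z \<in> carrier_vec n \<and>
     (\<exists>A \<in> carrier_mat n n. \<forall>e>0. \<exists>d>0. \<forall>h \<in> carrier_vec n. cvec_norm h < d \<longrightarrow>
        cvec_norm (f (z + h) - f z - A *\<^sub>v h) \<le> e * cvec_norm h))"

text \<open>Automorphisms are total functions of which only the restriction to the ball matters.\<close>

definition Aut_ball :: "nat \<Rightarrow> (complex vec \<Rightarrow> complex vec) set" where
  "Aut_ball n = {g. bij_betw g (unit_ball n) (unit_ball n) \<and>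
     holomorphic_map_on n (unit_ball n) g \<and>
     holomorphic_map_on n (unit_ball n) (inv_into (unit_ball n) g)}"

text \<open>For \<open>a = 0\<close> the coefficient is \<open>0 / 0 = 0\<close>, so the projection is then zero.\<close>

definition proj_span :: "complex vec \<Rightarrow> complex vec \<Rightarrow> complex vec" where
  "proj_span a z = ((z \<bullet>c a) / (a \<bullet>c a)) \<cdot>\<^sub>v a"

definition ball_invol :: "complex vec \<Rightarrow> complex vec \<Rightarrow> complex vec" where
  "ball_invol a z = (1 / (1 - z \<bullet>c a)) \<cdot>\<^sub>v
     (a - proj_span a z - complex_of_real (sqrt (1 - (cvec_norm a)\<^sup>2)) \<cdot>\<^sub>v (z - proj_span a z))"

definition pseudohyp_dist :: "complex vec \<Rightarrow> complex vec \<Rightarrow> real" where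
  "pseudohyp_dist a b = cvec_norm (ball_invol a b)"

definition kos :: "complex vec \<Rightarrow> complex vec \<Rightarrow> complex vec \<Rightarrow> complex" where
  "kos x y z =
     (complex_of_real (1 / cvec_norm (ball_invol x y)) \<cdot>\<^sub>v ball_invol x y) \<bullet>c
     (complex_of_real (1 / cvec_norm (ball_invol x z)) \<cdot>\<^sub>v ball_invol x z)"

definition point_tuple :: "nat \<Rightarrow> complex vec list \<Rightarrow> bool" where
  "point_tuple n ps \<longleftrightarrow> set ps \<subseteq> unit_ball n \<and> distinct ps"

definition triangle :: "nat \<Rightarrow> complex vec list \<Rightarrow> bool" where
  "triangle n ps \<longleftrightarrow> length ps = 3 \<and> point_tuple n ps"

definition tetrahedron :: "nat \<Rightarrow> complex vec list \<Rightarrow> bool" where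
  "tetrahedron n ps \<longleftrightarrow> length ps = 4 \<and> point_tuple n ps"

definition embed_vec :: "nat \<Rightarrow> complex vec \<Rightarrow> complex vec" where
  "embed_vec r z = z @\<^sub>v 0\<^sub>v (r - dim_vec z)"

text \<open>
  \<open>congruent n ps m qs\<close>: the tuple \<open>ps\<close> of points of the \<open>n\<close>-ball is congruent to the tuple
  \<open>qs\<close> of points of the \<open>m\<close>-ball, both being included in the larger one of the two balls.
\<close>

definition congruent :: "nat \<Rightarrow> complex vec list \<Rightarrow> nat \<Rightarrow> complex vec list \<Rightarrow> bool" where
  "congruent n ps m qs \<longleftrightarrow> (\<exists>g \<in> Aut_ball (max n m).
     map (\<lambda>p. g (embed_vec (max n m) p)) ps = map (embed_vec (max n m)) qs)"

definition psd_mat :: "nat \<Rightarrow> complex mat \<Rightarrow> bool" where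
  "psd_mat n A \<longleftrightarrow> A \<in> carrier_mat n n \<and> mat_adjoint A = A \<and>
     (\<forall>v \<in> carrier_vec n. 0 \<le> (A *\<^sub>v v) \<bullet>c v)"

definition kos_mat :: "complex \<Rightarrow> complex \<Rightarrow> complex \<Rightarrow> complex mat" where
  "kos_mat K23 K24 K34 = mat_of_rows_list 3
     [[1, K23, K24],
      [cnj K23, 1, K34],
      [cnj K24, cnj K34, 1]]"

text \<open>A tetrahedron \<open>(x\<^sub>1, x\<^sub>2, x\<^sub>3, x\<^sub>4)\<close> is a list counted from \<open>0\<close>, as are matrix indices:
  entry \<open>(i, j)\<close> here is the entry with indices \<open>i + 2, j + 2\<close> in the range \<open>2, 3, 4\<close>.\<close>

definition kos_mat_tetra :: "complex vec list \<Rightarrow> complex mat" where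
  "kos_mat_tetra X = Matrix.mat 3 3 (\<lambda>(i, j). kos (X ! 0) (X ! (i + 1)) (X ! (j + 1)))"

text \<open>\<open>assembles n2 T2 n3 T3 n4 T4 m X\<close> is the relation \<open>{T\<^sub>i} \<rightrightarrows> X\<close>.\<close>

definition assembles :: "nat \<Rightarrow> complex vec list \<Rightarrow> nat \<Rightarrow> complex vec list \<Rightarrow>
    nat \<Rightarrow> complex vec list \<Rightarrow> nat \<Rightarrow> complex vec list \<Rightarrow> bool" where
  "assembles n2 T2 n3 T3 n4 T4 m X \<longleftrightarrow>
     congruent n2 T2 m [X ! 0, X ! 1, X ! 2] \<and>
     congruent n3 T3 m [X ! 0, X ! 2, X ! 3] \<and>
     congruent n4 T4 m [X ! 0, X ! 3, X ! 1]"

end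

theory Submission
  imports Defs
begin

text \<open>
  An automorphism of the ball fixing the origin is unitary (Schwarz lemma), so conjugating with the
  involutions \<open>\<phi>\<^sub>a\<close> shows that \<open>\<langle>\<phi>\<^sub>x y, \<phi>\<^sub>x z\<rangle>\<close> is invariant under automorphisms. Conversely, two
  pairs of vectors with the same Gram matrix are related by a unitary map, so a triangle
  \<open>(x, y, z)\<close> is determined up to congruence by \<open>\<delta>(x, y)\<close>, \<open>\<delta>(x, z)\<close> and \<open>kos\<^sub>x(y, z)\<close>.
  Hence a tetrahedron with \<open>x\<^sub>1 = 0\<close> having the prescribed faces is the same as three unit vectors
  with Gram matrix \<open>\<M>\<close>, scaled by the side lengths. Such vectors exist exactly when \<open>\<M>\<close> is
  positive semidefinite, and since \<open>|K\<^sub>2\<^sub>3|, |K\<^sub>2\<^sub>4| \<le> 1\<close>, this is governed by the determinant of the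
  Schur complement of the first diagonal entry.
\<close>

subsection \<open>The Hermitian product and its norm\<close>

text \<open>Complex analysis enters only through the one-variable Schwarz lemma, applied to slices
  \<open>\<zeta> \<mapsto> \<langle>f (\<zeta> u), v\<rangle>\<close> whose direction
  \<open>v\<close> is adapted to a value of \<open>f\<close>; the derivative at 0 then supplies the
  matrix. A triangle based at 0 amounts to two vectors, so two Householder maps yield the required
  unitary map, for linearly dependent pairs as well. A nonnegative determinant does not by itself
  make such a matrix positive semidefinite: with all three entries equal to 2 it is 5, although -1
  is an eigenvalue. The bounds on \<open>K23\<close> and \<open>K24\<close> close this gap, and they
  hold because both are products of vectors of norm at most 1. Under them the determinant inequality
  is exactly the condition for an explicit Cholesky factorization in dimension 3, so the tetrahedron
  is always found in the 3-ball. The matrix may have off-diagonal entries equal to 1, so it cannot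
  show that the vertices are distinct; that information has to come back from the given
  triangles.\<close>

lemma cip_sum:
  assumes "dim_vec u = dim_vec v"
  shows "u \<bullet>c v = (\<Sum>i<dim_vec v. vec_index u i * cnj (vec_index v i))"
  using assms by (simp add: scalar_prod_def atLeast0LessThan)

lemma cip_add_left:
  fixes u v w :: "complex vec"
  assumes "dim_vec u = dim_vec w" "dim_vec v = dim_vec w"
  shows "(u + v) \<bullet>c w = u \<bullet>c w + v \<bullet>c w"
  using assms by (simp add: cip_sum algebra_simps sum.distrib)

lemma cip_add_right:
  fixes u v w :: "complex vec"
  assumes "dim_vec u = dim_vec w" "dim_vec v = dim_vec w"
  shows "w \<bullet>c (u + v) = w \<bullet>c u + w \<bullet>c v"
  using assms by (simp add: cip_sum algebra_simps sum.distrib)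

lemma cip_diff_left:
  fixes u v w :: "complex vec"
  assumes "dim_vec u = dim_vec w" "dim_vec v = dim_vec w"
  shows "(u - v) \<bullet>c w = u \<bullet>c w - v \<bullet>c w"
  using assms by (simp add: cip_sum algebra_simps sum_subtractf)

lemma cip_diff_right:
  fixes u v w :: "complex vec"
  assumes "dim_vec u = dim_vec w" "dim_vec v = dim_vec w"
  shows "w \<bullet>c (u - v) = w \<bullet>c u - w \<bullet>c v"
  using assms by (simp add: cip_sum algebra_simps sum_subtractf)

lemma cip_smult_left:
  fixes u w :: "complex vec"
  assumes "dim_vec u = dim_vec w"
  shows "(c \<cdot>\<^sub>v u) \<bullet>c w = c * (u \<bullet>c w)"
  using assms by (simp add: cip_sum algebra_simps sum_distrib_left)

lemma cip_smult_right:
  fixes u w :: "complex vec"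
  assumes "dim_vec u = dim_vec w"
  shows "w \<bullet>c (c \<cdot>\<^sub>v u) = cnj c * (w \<bullet>c u)"
  using assms by (simp add: cip_sum algebra_simps sum_distrib_left)

lemmas cip_linear = cip_add_left cip_add_right cip_diff_left cip_diff_right
  cip_smult_left cip_smult_right

lemma cnj_cip:
  assumes "dim_vec u = dim_vec v"
  shows "cnj (u \<bullet>c v) = v \<bullet>c u"
  using assms by (simp add: cip_sum mult.commute)

lemma cip_self_sum: "u \<bullet>c u = of_real (\<Sum>i<dim_vec u. (cmod (vec_index u i))\<^sup>2)"
  by (simp add: cip_sum complex_norm_square del: of_real_power)

lemma cvec_norm_L2: "cvec_norm u = L2_set (\<lambda>i. cmod (vec_index u i)) {..<dim_vec u}"
  by (simp add: cvec_norm_def cip_self_sum L2_set_def)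

lemma cvec_norm_nonneg [simp]: "0 \<le> cvec_norm u"
  by (simp add: cvec_norm_L2)

lemma cip_self: "u \<bullet>c u = of_real ((cvec_norm u)\<^sup>2)"
  unfolding cip_self_sum cvec_norm_L2 L2_set_def by (simp add: sum_nonneg)

lemma cvec_norm_eqI: "u \<bullet>c u = v \<bullet>c v \<Longrightarrow> cvec_norm u = cvec_norm v"
  by (simp add: cvec_norm_def)

lemma cvec_norm_smult [simp]: "cvec_norm (c \<cdot>\<^sub>v u) = cmod c * cvec_norm u"
proof -
  have "cvec_norm (c \<cdot>\<^sub>v u) = L2_set (\<lambda>i. cmod c * cmod (vec_index u i)) {..<dim_vec u}"
    unfolding cvec_norm_L2 by (intro L2_set_cong) (auto simp: norm_mult)
  then show ?thesis
    by (simp add: cvec_norm_L2 L2_set_right_distrib)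
qed

lemma cvec_norm_eq_0_iff: "cvec_norm u = 0 \<longleftrightarrow> u = 0\<^sub>v (dim_vec u)"
  by (auto simp: cvec_norm_L2 L2_set_eq_0_iff intro!: eq_vecI) (metis index_zero_vec(1))

lemma cvec_norm_zero [simp]: "cvec_norm (0\<^sub>v n) = 0"
  by (simp add: cvec_norm_eq_0_iff)

lemma cvec_norm_triangle:
  assumes "dim_vec u = dim_vec v"
  shows "cvec_norm (u + v) \<le> cvec_norm u + cvec_norm v"
proof -
  have "cvec_norm (u + v) \<le>
      L2_set (\<lambda>i. cmod (vec_index u i) + cmod (vec_index v i)) {..<dim_vec v}"
    unfolding cvec_norm_L2 using assms by (auto intro!: L2_set_mono norm_triangle_ineq)
  also have "\<dots> \<le> cvec_norm u + cvec_norm v"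
    unfolding cvec_norm_L2 using assms by (simp add: L2_set_triangle_ineq)
  finally show ?thesis .
qed

lemma cvec_Cauchy_Schwarz:
  assumes "dim_vec u = dim_vec v"
  shows "cmod (u \<bullet>c v) \<le> cvec_norm u * cvec_norm v"
proof -
  have "cmod (u \<bullet>c v) \<le> (\<Sum>i<dim_vec v. \<bar>cmod (vec_index u i)\<bar> * \<bar>cmod (vec_index v i)\<bar>)"
    unfolding cip_sum[OF assms] by (intro sum_norm_le) (auto simp: norm_mult)
  also have "\<dots> \<le> cvec_norm u * cvec_norm v"
    unfolding cvec_norm_L2 using assms L2_set_mult_ineq by metis
  finally show ?thesis .
qed

lemma mult_mat_vec_bounded:
  fixes A :: "complex mat"
  assumes "A \<in> carrier_mat n n"
  obtains C where "C > 0" "\<And>h. h \<in> carrier_vec n \<Longrightarrow> cvec_norm (A *\<^sub>v h) \<le> C * cvec_norm h"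
proof
  \<comment> \<open>Each coordinate of the image is the product of \<open>h\<close> with a
    conjugated row, so Cauchy-Schwarz bounds it by the norm of that row. The added 1 keeps the
    constant positive for a zero matrix.\<close>
  let ?C = "(\<Sum>i<n. cvec_norm (conjugate (row A i)))"
  show "?C + 1 > 0"
    by (simp add: sum_nonneg add_nonneg_pos)
  fix h :: "complex vec" assume h: "h \<in> carrier_vec n"
  have "cvec_norm (A *\<^sub>v h) \<le> (\<Sum>i<n. cmod (vec_index (A *\<^sub>v h) i))"
    using assms L2_set_le_sum[of "{..<n}" "\<lambda>i. cmod (vec_index (A *\<^sub>v h) i)"]
    by (simp add: cvec_norm_L2[of "A *\<^sub>v h"] del: index_mult_mat_vec)
  also have "\<dots> \<le> (\<Sum>i<n. cvec_norm (conjugate (row A i)) * cvec_norm h)"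
  proof (intro sum_mono)
    fix i assume i: "i \<in> {..<n}"
    have "vec_index (A *\<^sub>v h) i = h \<bullet>c conjugate (row A i)"
      using i assms h by (simp add: comm_scalar_prod[of _ n])
    then show "cmod (vec_index (A *\<^sub>v h) i) \<le> cvec_norm (conjugate (row A i)) * cvec_norm h"
      using cvec_Cauchy_Schwarz[of h "conjugate (row A i)"] assms h by (simp add: mult.commute)
  qed
  also have "\<dots> \<le> (?C + 1) * cvec_norm h"
    by (simp add: sum_distrib_right distrib_right)
  finally show "cvec_norm (A *\<^sub>v h) \<le> (?C + 1) * cvec_norm h" .
qed

subsection \<open>Holomorphic maps and automorphisms of the ball\<close>

text \<open>Names the inner condition of \<open>holomorphic_map_on\<close>, so that the chain rule
  and Cartan's theorem can speak about the derivative matrix itself.\<close>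

definition has_cderiv :: "nat \<Rightarrow> (complex vec \<Rightarrow> complex vec) \<Rightarrow> complex vec \<Rightarrow> complex mat \<Rightarrow> bool" where
  "has_cderiv n f z A \<longleftrightarrow> A \<in> carrier_mat n n \<and> (\<forall>e>0. \<exists>d>0. \<forall>h \<in> carrier_vec n.
     cvec_norm h < d \<longrightarrow> cvec_norm (f (z + h) - f z - A *\<^sub>v h) \<le> e * cvec_norm h)"

lemma holomorphic_map_on_iff:
  "holomorphic_map_on n U f \<longleftrightarrow> (\<forall>z\<in>U. f z \<in> carrier_vec n \<and> (\<exists>A. has_cderiv n f z A))"
  unfolding holomorphic_map_on_def has_cderiv_def by blast

lemma unit_ball_iff: "z \<in> unit_ball n \<longleftrightarrow> z \<in> carrier_vec n \<and> cvec_norm z < 1"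
  by (simp add: unit_ball_def)

lemma unit_ball_carrier: "z \<in> unit_ball n \<Longrightarrow> z \<in> carrier_vec n"
  by (simp add: unit_ball_def)

lemma unit_ball_add:
  assumes "z \<in> unit_ball n" "h \<in> carrier_vec n" "cvec_norm h < 1 - cvec_norm z"
  shows "z + h \<in> unit_ball n"
  using assms cvec_norm_triangle[of z h] by (auto simp: unit_ball_iff)

text \<open>Formulas for the maps are controlled only inside the ball. Shrinking \<open>d\<close>
  below \<open>1 - cvec_norm z\<close> excludes every increment that leaves it.\<close>

lemma has_cderivI:
  assumes z: "z \<in> unit_ball n" and A: "A \<in> carrier_mat n n"
    and *: "\<And>e. e > 0 \<Longrightarrow> \<exists>d>0. \<forall>h \<in> carrier_vec n. z + h \<in> unit_ball n \<longrightarrow> cvec_norm h < d \<longrightarrow>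
      cvec_norm (f (z + h) - f z - A *\<^sub>v h) \<le> e * cvec_norm h"
  shows "has_cderiv n f z A"
  unfolding has_cderiv_def
proof (intro conjI A allI impI)
  fix e :: real assume "e > 0"
  from *[OF this] obtain d where d: "d > 0" "\<forall>h \<in> carrier_vec n. z + h \<in> unit_ball n \<longrightarrow>
      cvec_norm h < d \<longrightarrow> cvec_norm (f (z + h) - f z - A *\<^sub>v h) \<le> e * cvec_norm h"
    by blast
  show "\<exists>d>0. \<forall>h\<in>carrier_vec n. cvec_norm h < d \<longrightarrow>
      cvec_norm (f (z + h) - f z - A *\<^sub>v h) \<le> e * cvec_norm h"
    by (rule exI[of _ "min d (1 - cvec_norm z)"])
      (use d z unit_ball_add[OF z] in \<open>auto simp: unit_ball_iff\<close>)
qed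

lemma has_cderivD:
  assumes "has_cderiv n f z A" "e > 0"
  obtains d where "d > 0" "\<And>h. h \<in> carrier_vec n \<Longrightarrow> cvec_norm h < d \<Longrightarrow>
      cvec_norm (f (z + h) - f z - A *\<^sub>v h) \<le> e * cvec_norm h"
  using assms unfolding has_cderiv_def by blast

lemma has_cderiv_carrier: "has_cderiv n f z A \<Longrightarrow> A \<in> carrier_mat n n"
  by (simp add: has_cderiv_def)

text \<open>Needed for \<open>inv_into\<close>, which agrees with an explicit inverse only on the
  ball.\<close>

lemma holomorphic_map_on_cong:
  assumes "holomorphic_map_on n (unit_ball n) f" "\<And>z. z \<in> unit_ball n \<Longrightarrow> f z = g z"
  shows "holomorphic_map_on n (unit_ball n) g"
  unfolding holomorphic_map_on_iff
proof (intro ballI conjI)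
  fix z assume z: "z \<in> unit_ball n"
  with assms obtain A where A: "has_cderiv n f z A"
    unfolding holomorphic_map_on_iff by blast
  show "g z \<in> carrier_vec n"
    using assms z unfolding holomorphic_map_on_iff by metis
  have "has_cderiv n g z A"
  proof (rule has_cderivI[OF z has_cderiv_carrier[OF A]])
    fix e :: real assume "e > 0"
    with A obtain d where "d > 0" "\<And>h. h \<in> carrier_vec n \<Longrightarrow> cvec_norm h < d \<Longrightarrow>
      cvec_norm (f (z + h) - f z - A *\<^sub>v h) \<le> e * cvec_norm h"
      using has_cderivD by blast
    then show "\<exists>d>0. \<forall>h \<in> carrier_vec n. z + h \<in> unit_ball n \<longrightarrow> cvec_norm h < d \<longrightarrow>
      cvec_norm (g (z + h) - g z - A *\<^sub>v h) \<le> e * cvec_norm h"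
      using assms(2) z by (intro exI[of _ d]) (metis)
  qed
  then show "\<exists>A. has_cderiv n g z A" ..
qed

lemma has_cderiv_compose:
  assumes f: "has_cderiv n f z A" and g: "has_cderiv n g (f z) B"
    and z: "z \<in> unit_ball n" and fU: "f ` unit_ball n \<subseteq> carrier_vec n"
    and gfU: "(g \<circ> f) ` unit_ball n \<subseteq> carrier_vec n"
  shows "has_cderiv n (g \<circ> f) z (B * A)"
proof (rule has_cderivI[OF z])
  have A: "A \<in> carrier_mat n n" and B: "B \<in> carrier_mat n n"
    using f g by (auto dest: has_cderiv_carrier)
  then show "B * A \<in> carrier_mat n n" by simp
  obtain CA where CA: "CA > 0" "\<And>h. h \<in> carrier_vec n \<Longrightarrow> cvec_norm (A *\<^sub>v h) \<le> CA * cvec_norm h"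
    using mult_mat_vec_bounded[OF A] by blast
  obtain CB where CB: "CB > 0" "\<And>h. h \<in> carrier_vec n \<Longrightarrow> cvec_norm (B *\<^sub>v h) \<le> CB * cvec_norm h"
    using mult_mat_vec_bounded[OF B] by blast
  fix e :: real assume e: "e > 0"
  \<comment> \<open>The remainder of the composite is \<open>q + B *\<^sub>v r\<close>, with
    \<open>r\<close> the remainder of \<open>f\<close> and \<open>q\<close> that of \<open>g\<close>
    at the increment \<open>k\<close>. The bound \<open>e1 \<le> 1\<close> gives
    \<open>|k| \<le> (CA + 1) |h|\<close>; the other factors are chosen so that \<open>q\<close> and
    \<open>B *\<^sub>v r\<close> each cost at most half of \<open>e\<close>.\<close>
  define e1 where "e1 = min 1 (e / (2 * CB))"
  define e2 where "e2 = e / (2 * (CA + 1))"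
  have e1: "e1 > 0" "e1 \<le> 1" "CB * e1 \<le> e / 2"
  proof -
    show "e1 > 0" "e1 \<le> 1"
      using e CB by (auto simp: e1_def)
    have "CB * e1 \<le> CB * (e / (2 * CB))"
      using CB by (intro mult_left_mono) (auto simp: e1_def)
    also have "\<dots> = e / 2"
      using CB by simp
    finally show "CB * e1 \<le> e / 2" .
  qed
  have e2: "e2 > 0" "e2 * (CA + 1) = e / 2"
    using e CA by (auto simp: e2_def field_simps)
  obtain d1 where d1: "d1 > 0" "\<And>h. h \<in> carrier_vec n \<Longrightarrow> cvec_norm h < d1 \<Longrightarrow>
      cvec_norm (f (z + h) - f z - A *\<^sub>v h) \<le> e1 * cvec_norm h"
    using has_cderivD[OF f e1(1)] by blast
  obtain d2 where d2: "d2 > 0" "\<And>h. h \<in> carrier_vec n \<Longrightarrow> cvec_norm h < d2 \<Longrightarrow>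
      cvec_norm (g (f z + h) - g (f z) - B *\<^sub>v h) \<le> e2 * cvec_norm h"
    using has_cderivD[OF g e2(1)] by blast
  show "\<exists>d>0. \<forall>h \<in> carrier_vec n. z + h \<in> unit_ball n \<longrightarrow> cvec_norm h < d \<longrightarrow>
      cvec_norm ((g \<circ> f) (z + h) - (g \<circ> f) z - B * A *\<^sub>v h) \<le> e * cvec_norm h"
  proof (intro exI[of _ "min d1 (d2 / (CA + 1))"] conjI ballI impI)
    show "0 < min d1 (d2 / (CA + 1))"
      using d1 d2 CA by simp
    fix h assume h: "h \<in> carrier_vec n" "z + h \<in> unit_ball n"
      and "cvec_norm h < min d1 (d2 / (CA + 1))"
    then have hd: "cvec_norm h < d1" "(CA + 1) * cvec_norm h < d2"
      using CA by (auto simp: field_simps)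
    define k where "k = f (z + h) - f z"
    define r where "r = k - A *\<^sub>v h"
    have fz: "f z \<in> carrier_vec n" "f (z + h) \<in> carrier_vec n"
      using fU z h by blast+
    have gz: "g (f z) \<in> carrier_vec n" "g (f (z + h)) \<in> carrier_vec n"
      using gfU z h by force+
    have Ah: "A *\<^sub>v h \<in> carrier_vec n"
      using A h by simp
    have k: "k \<in> carrier_vec n" and r: "r \<in> carrier_vec n"
      unfolding k_def r_def using fz Ah by auto
    have fzk: "f (z + h) = f z + k"
      using fz unfolding k_def by (intro eq_vecI) auto
    have nr: "cvec_norm r \<le> e1 * cvec_norm h"
      using d1(2)[OF h(1) hd(1)] by (simp add: r_def k_def)
    have "k = A *\<^sub>v h + r"
      using k Ah A unfolding r_def by (intro eq_vecI) auto
    then have "cvec_norm k \<le> cvec_norm (A *\<^sub>v h) + cvec_norm r"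
      using cvec_norm_triangle[of "A *\<^sub>v h" r] Ah r by (metis carrier_vecD)
    also have "\<dots> \<le> CA * cvec_norm h + 1 * cvec_norm h"
      using CA(2)[OF h(1)] nr mult_right_mono[OF e1(2) cvec_norm_nonneg[of h]] by linarith
    finally have nk: "cvec_norm k \<le> (CA + 1) * cvec_norm h"
      by (simp add: algebra_simps)
    define q where "q = g (f z + k) - g (f z) - B *\<^sub>v k"
    have Bk: "B *\<^sub>v k \<in> carrier_vec n" "B *\<^sub>v r \<in> carrier_vec n"
      using B k r by auto
    have q: "q \<in> carrier_vec n"
      unfolding q_def using gz fzk Bk by auto
    have "cvec_norm q \<le> e2 * cvec_norm k"
      unfolding q_def using d2(2)[OF k] nk hd by linarith
    also have "\<dots> \<le> e2 * ((CA + 1) * cvec_norm h)"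
      using nk e2 by (intro mult_left_mono) auto
    also have "\<dots> = e / 2 * cvec_norm h"
      using e2(2) by (metis mult.assoc)
    finally have nq: "cvec_norm q \<le> e / 2 * cvec_norm h" .
    have "cvec_norm (B *\<^sub>v r) \<le> CB * (e1 * cvec_norm h)"
      using CB(2)[OF r] mult_left_mono[OF nr, of CB] CB(1) by linarith
    also have "\<dots> = (CB * e1) * cvec_norm h"
      by simp
    also have "\<dots> \<le> e / 2 * cvec_norm h"
      using e1(3) by (intro mult_right_mono) auto
    finally have nBr: "cvec_norm (B *\<^sub>v r) \<le> e / 2 * cvec_norm h" .
    have "B *\<^sub>v r = B *\<^sub>v k - B * A *\<^sub>v h"
      unfolding r_def using A B k h Ah by (simp add: mult_minus_distrib_mat_vec)
    then have "(g \<circ> f) (z + h) - (g \<circ> f) z - B * A *\<^sub>v h = q + B *\<^sub>v r"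
      unfolding q_def fzk[symmetric] comp_apply using gz Bk A B h by (intro eq_vecI) auto
    then show "cvec_norm ((g \<circ> f) (z + h) - (g \<circ> f) z - B * A *\<^sub>v h) \<le> e * cvec_norm h"
      using cvec_norm_triangle[of q "B *\<^sub>v r"] q Bk nq nBr
      by (simp add: carrier_vecD[OF q] carrier_vecD[OF Bk(2)] del: dim_mult_mat_vec)
  qed
qed

lemma holomorphic_map_on_compose:
  assumes f: "holomorphic_map_on n (unit_ball n) f" and g: "holomorphic_map_on n (unit_ball n) g"
    and fU: "f ` unit_ball n \<subseteq> unit_ball n"
  shows "holomorphic_map_on n (unit_ball n) (g \<circ> f)"
  unfolding holomorphic_map_on_iff
proof (intro ballI conjI)
  have car: "f ` unit_ball n \<subseteq> carrier_vec n" "(g \<circ> f) ` unit_ball n \<subseteq> carrier_vec n"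
    using f g fU unfolding holomorphic_map_on_iff by auto
  fix z assume z: "z \<in> unit_ball n"
  then show "(g \<circ> f) z \<in> carrier_vec n"
    using car by blast
  obtain A B where "has_cderiv n f z A" "has_cderiv n g (f z) B"
    using f g fU z unfolding holomorphic_map_on_iff by blast
  then show "\<exists>A. has_cderiv n (g \<circ> f) z A"
    using has_cderiv_compose[OF _ _ z car] by blast
qed

text \<open>On the ball \<open>inv_into\<close> coincides with any two-sided inverse, so holomorphy
  may be checked on an explicit \<open>g\<close>.\<close>

lemma Aut_ballI:
  assumes "\<And>z. z \<in> unit_ball n \<Longrightarrow> f z \<in> unit_ball n" "\<And>z. z \<in> unit_ball n \<Longrightarrow> g z \<in> unit_ball n"
    and "\<And>z. z \<in> unit_ball n \<Longrightarrow> g (f z) = z" "\<And>z. z \<in> unit_ball n \<Longrightarrow> f (g z) = z"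
    and "holomorphic_map_on n (unit_ball n) f" "holomorphic_map_on n (unit_ball n) g"
  shows "f \<in> Aut_ball n"
proof -
  have bij: "bij_betw f (unit_ball n) (unit_ball n)"
    using assms(1-4) by (intro bij_betw_byWitness[where f' = g]) auto
  have "inv_into (unit_ball n) f z = g z" if "z \<in> unit_ball n" for z
    using that assms(2,4) bij by (metis bij_betw_inv_into_left)
  then have "holomorphic_map_on n (unit_ball n) (inv_into (unit_ball n) f)"
    using holomorphic_map_on_cong[OF assms(6)] by metis
  with bij assms(5) show ?thesis
    by (simp add: Aut_ball_def)
qed

lemma Aut_ballE:
  assumes "f \<in> Aut_ball n"
  obtains g where "\<And>z. z \<in> unit_ball n \<Longrightarrow> f z \<in> unit_ball n"
    "\<And>z. z \<in> unit_ball n \<Longrightarrow> g z \<in> unit_ball n"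
    "\<And>z. z \<in> unit_ball n \<Longrightarrow> g (f z) = z" "\<And>z. z \<in> unit_ball n \<Longrightarrow> f (g z) = z"
    "holomorphic_map_on n (unit_ball n) f" "holomorphic_map_on n (unit_ball n) g"
proof -
  have bij: "bij_betw f (unit_ball n) (unit_ball n)"
    using assms by (simp add: Aut_ball_def)
  show thesis
    by (rule that[of "inv_into (unit_ball n) f"])
      (use assms bij in \<open>auto simp: Aut_ball_def bij_betw_inv_into_left bij_betw_inv_into_right
        intro: bij_betwE[THEN bspec] bij_betw_inv_into[THEN bij_betwE, THEN bspec]\<close>)
qed

lemma Aut_ball_compose:
  assumes "f \<in> Aut_ball n" "g \<in> Aut_ball n"
  shows "g \<circ> f \<in> Aut_ball n"
proof -
  obtain f' where f: "\<And>z. z \<in> unit_ball n \<Longrightarrow> f z \<in> unit_ball n"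
    "\<And>z. z \<in> unit_ball n \<Longrightarrow> f' z \<in> unit_ball n"
    "\<And>z. z \<in> unit_ball n \<Longrightarrow> f' (f z) = z" "\<And>z. z \<in> unit_ball n \<Longrightarrow> f (f' z) = z"
    "holomorphic_map_on n (unit_ball n) f" "holomorphic_map_on n (unit_ball n) f'"
    using Aut_ballE[OF assms(1)] by blast
  obtain g' where g: "\<And>z. z \<in> unit_ball n \<Longrightarrow> g z \<in> unit_ball n"
    "\<And>z. z \<in> unit_ball n \<Longrightarrow> g' z \<in> unit_ball n"
    "\<And>z. z \<in> unit_ball n \<Longrightarrow> g' (g z) = z" "\<And>z. z \<in> unit_ball n \<Longrightarrow> g (g' z) = z"
    "holomorphic_map_on n (unit_ball n) g" "holomorphic_map_on n (unit_ball n) g'"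
    using Aut_ballE[OF assms(2)] by blast
  have "holomorphic_map_on n (unit_ball n) (g \<circ> f)" "holomorphic_map_on n (unit_ball n) (f' \<circ> g')"
    using f g by (auto intro!: holomorphic_map_on_compose)
  then show ?thesis
    by (intro Aut_ballI[of _ _ "f' \<circ> g'"]) (simp_all add: f(1-4) g(1-4))
qed

subsection \<open>The involutions\<close>

text \<open>Both the derivative of an involution and a complex Householder map have this
  form.\<close>

lemma rank_one_plus_scalar_mat:
  fixes a v :: "complex vec"
  assumes "a \<in> carrier_vec n" "v \<in> carrier_vec n"
  obtains A where "A \<in> carrier_mat n n"
    "\<And>h. h \<in> carrier_vec n \<Longrightarrow> A *\<^sub>v h = (h \<bullet>c a) \<cdot>\<^sub>v v + b \<cdot>\<^sub>v h"
proof
  let ?A = "Matrix.mat n n (\<lambda>(i, j). vec_index v i * cnj (vec_index a j) + (if i = j then b else 0))"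
  show "?A \<in> carrier_mat n n" by simp
  fix h :: "complex vec" assume h: "h \<in> carrier_vec n"
  show "?A *\<^sub>v h = (h \<bullet>c a) \<cdot>\<^sub>v v + b \<cdot>\<^sub>v h"
  proof (rule eq_vecI)
    fix i assume "i < dim_vec ((h \<bullet>c a) \<cdot>\<^sub>v v + b \<cdot>\<^sub>v h)"
    then have i: "i < n" using h by simp
    have "vec_index (?A *\<^sub>v h) i =
        (\<Sum>j<n. (vec_index v i * cnj (vec_index a j) + (if i = j then b else 0)) * vec_index h j)"
      using i h by (simp add: scalar_prod_def atLeast0LessThan)
    also have "\<dots> = (\<Sum>j<n. vec_index v i * (vec_index h j * cnj (vec_index a j)))
        + (\<Sum>j<n. if i = j then b * vec_index h j else 0)"
      unfolding sum.distrib[symmetric] by (intro sum.cong) (auto simp: algebra_simps)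
    also have "\<dots> = vec_index ((h \<bullet>c a) \<cdot>\<^sub>v v + b \<cdot>\<^sub>v h) i"
      using i h assms by (simp add: cip_sum sum_distrib_left mult.commute)
    finally show "vec_index (?A *\<^sub>v h) i = vec_index ((h \<bullet>c a) \<cdot>\<^sub>v v + b \<cdot>\<^sub>v h) i" .
  qed (use h in simp)
qed

lemma has_cderiv_linear:
  assumes A: "A \<in> carrier_mat n n" and z: "z \<in> carrier_vec n"
  shows "has_cderiv n (\<lambda>z. A *\<^sub>v z) z A"
proof -
  have "A *\<^sub>v (z + h) - A *\<^sub>v z - A *\<^sub>v h = 0\<^sub>v n" if "h \<in> carrier_vec n" for h
    using A z that by (intro eq_vecI) (auto simp: mult_add_distrib_mat_vec)
  then show ?thesis
    unfolding has_cderiv_def using A by (auto intro!: exI[of _ 1])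
qed

lemma holomorphic_linear:
  assumes "A \<in> carrier_mat n n"
  shows "holomorphic_map_on n (unit_ball n) (\<lambda>z. A *\<^sub>v z)"
  unfolding holomorphic_map_on_iff
  using assms by (auto dest!: unit_ball_carrier intro!: has_cderiv_linear)

definition hol_coeff :: "complex vec \<Rightarrow> real" where
  "hol_coeff a = sqrt (1 - (cvec_norm a)\<^sup>2)"

lemma hol_coeff:
  assumes "cvec_norm a < 1"
  shows "hol_coeff a > 0" "(hol_coeff a)\<^sup>2 = 1 - (cvec_norm a)\<^sup>2"
proof -
  have "(cvec_norm a)\<^sup>2 < 1"
    using assms by (simp add: power_less_one_iff abs_square_less_1)
  then show "hol_coeff a > 0" "(hol_coeff a)\<^sup>2 = 1 - (cvec_norm a)\<^sup>2"
    by (simp_all add: hol_coeff_def)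
qed

text \<open>Removes the division by \<open>a \<bullet>c a\<close>, which may vanish. The two
  projection terms combine to \<open>(1 - s) P z\<close>, and
  \<open>a \<bullet>c a = (1 - s) (1 + s)\<close> cancels the factor \<open>1 - s\<close>, leaving
  the denominator \<open>1 + s\<close>, which is never 0.\<close>

lemma ball_invol_eq:
  assumes a: "a \<in> unit_ball n" and z: "z \<in> carrier_vec n"
  defines "s \<equiv> complex_of_real (hol_coeff a)"
  shows "ball_invol a z = (1 / (1 - z \<bullet>c a)) \<cdot>\<^sub>v ((1 - (z \<bullet>c a) / (1 + s)) \<cdot>\<^sub>v a - s \<cdot>\<^sub>v z)"
proof -
  have ac: "a \<in> carrier_vec n" "cvec_norm a < 1"
    using a by (auto simp: unit_ball_iff)
  have "1 + hol_coeff a \<noteq> 0" using hol_coeff[OF ac(2)] by linarith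
  then have s: "1 + s \<noteq> 0"
    unfolding s_def by (metis of_real_1 of_real_add of_real_eq_0_iff)
  have "a \<bullet>c a = of_real (1 - (hol_coeff a)\<^sup>2)"
    unfolding cip_self using hol_coeff[OF ac(2)] by simp
  then have aa: "a \<bullet>c a = (1 - s) * (1 + s)"
    by (simp add: s_def power2_eq_square algebra_simps)
  have key: "(1 - s) * ((z \<bullet>c a) / (a \<bullet>c a) * vec_index a i) = (z \<bullet>c a) / (1 + s) * vec_index a i"
    if i: "i < n" for i
  proof (cases "a \<bullet>c a = 0")
    case True
    then have "vec_index a i = 0"
      using ac i by (simp add: cip_self cvec_norm_eq_0_iff)
    then show ?thesis by simp
  next
    case False
    then have "1 - s \<noteq> 0" by (auto simp: aa)
    then show ?thesis using s unfolding aa by simp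
  qed
  have "a - proj_span a z - s \<cdot>\<^sub>v (z - proj_span a z) = (1 - (z \<bullet>c a) / (1 + s)) \<cdot>\<^sub>v a - s \<cdot>\<^sub>v z"
  proof (rule eq_vecI)
    fix i assume "i < dim_vec ((1 - (z \<bullet>c a) / (1 + s)) \<cdot>\<^sub>v a - s \<cdot>\<^sub>v z)"
    then have i: "i < n" using z ac by simp
    define p where "p = vec_index (proj_span a z) i"
    have "(1 - s) * p = (z \<bullet>c a) / (1 + s) * vec_index a i"
      using key[OF i] i ac by (simp add: p_def proj_span_def)
    moreover have "vec_index a i - p - s * (vec_index z i - p) =
        vec_index a i - (1 - s) * p - s * vec_index z i"
      by (simp add: left_diff_distrib right_diff_distrib)
    ultimately have "vec_index a i - p - s * (vec_index z i - p) =
        (1 - (z \<bullet>c a) / (1 + s)) * vec_index a i - s * vec_index z i"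
      by (simp add: left_diff_distrib)
    moreover have "dim_vec (proj_span a z) = n"
      using ac by (simp add: proj_span_def)
    ultimately show "vec_index (a - proj_span a z - s \<cdot>\<^sub>v (z - proj_span a z)) i =
        vec_index ((1 - (z \<bullet>c a) / (1 + s)) \<cdot>\<^sub>v a - s \<cdot>\<^sub>v z) i"
      using z ac i by (simp add: p_def)
  qed (use z ac in \<open>simp add: proj_span_def\<close>)
  then show ?thesis
    unfolding ball_invol_def s_def hol_coeff_def by simp
qed

lemma one_minus_cip_nonzero:
  assumes "a \<in> unit_ball n" "z \<in> unit_ball n"
  shows "1 - z \<bullet>c a \<noteq> 0"
proof
  assume "1 - z \<bullet>c a = 0"
  then have "cmod (z \<bullet>c a) = 1" by simp
  moreover have "cmod (z \<bullet>c a) \<le> cvec_norm z * cvec_norm a"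
    using assms by (intro cvec_Cauchy_Schwarz) (auto simp: unit_ball_iff)
  moreover have "cvec_norm z * cvec_norm a < 1"
    using assms mult_left_le[of "cvec_norm a" "cvec_norm z"] by (simp add: unit_ball_iff)
  ultimately show False by simp
qed

lemma ball_invol_carrier:
  assumes "a \<in> unit_ball n" "z \<in> carrier_vec n"
  shows "ball_invol a z \<in> carrier_vec n"
  unfolding ball_invol_eq[OF assms] using assms by (auto simp: unit_ball_iff)

text \<open>The scalar computations behind the involutions: \<open>t = 1 / (1 + s)\<close>,
  \<open>x = \<langle>z, a\<rangle>\<close> with conjugate \<open>x'\<close>,
  \<open>1 - s\<^sup>2 = \<langle>a, a\<rangle>\<close> and
  \<open>Z = \<langle>z, z\<rangle>\<close>. All of them reduce to
  \<open>t (1 - s\<^sup>2) = 1 - s\<close>. The first two serve the involution property, the third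
  computes the norm of the image.\<close>

lemma ball_invol_identities:
  fixes s t x x' Z :: complex
  assumes "t * (1 + s) = 1"
  shows "(1 - x * t) * (1 - s\<^sup>2) - s * x = 1 - s\<^sup>2 - x"
    and "1 - x - (1 - s\<^sup>2 - x) * t = s * (1 - x * t)"
    and "(1 - x * t) * (1 - x' * t) * (1 - s\<^sup>2) - s * ((1 - x * t) * x' + (1 - x' * t) * x)
      + s\<^sup>2 * Z = (1 - x) * (1 - x') - s\<^sup>2 * (1 - Z)"
proof -
  have "t * (1 - s\<^sup>2) = (t * (1 + s)) * (1 - s)"
    by (simp add: algebra_simps power2_eq_square)
  then have T: "t * (1 - s\<^sup>2) = 1 - s"
    using assms by simp
  have "(1 - x * t) * (1 - s\<^sup>2) = 1 - s\<^sup>2 - x * (t * (1 - s\<^sup>2))"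
    by (simp add: algebra_simps)
  then show "(1 - x * t) * (1 - s\<^sup>2) - s * x = 1 - s\<^sup>2 - x"
    unfolding T by (simp add: algebra_simps)
  have "1 - x - (1 - s\<^sup>2 - x) * t = 1 - x - t * (1 - s\<^sup>2) + x * t"
    by (simp add: algebra_simps)
  also have "\<dots> = s * (1 - x * t) + x * (t * (1 + s)) - x"
    unfolding T by (simp add: algebra_simps)
  finally show "1 - x - (1 - s\<^sup>2 - x) * t = s * (1 - x * t)"
    unfolding assms by simp
  have "(1 - x * t) * (1 - x' * t) * (1 - s\<^sup>2) =
      1 - s\<^sup>2 - (x + x') * (t * (1 - s\<^sup>2)) + x * x' * t * (t * (1 - s\<^sup>2))"
    by (simp add: algebra_simps)
  also have "\<dots> - s * ((1 - x * t) * x' + (1 - x' * t) * x) + s\<^sup>2 * Z =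
      1 - s\<^sup>2 - (x + x') + x * x' * (t * (1 + s)) + s\<^sup>2 * Z"
    unfolding T by (simp add: algebra_simps)
  finally show "(1 - x * t) * (1 - x' * t) * (1 - s\<^sup>2) - s * ((1 - x * t) * x' + (1 - x' * t) * x)
      + s\<^sup>2 * Z = (1 - x) * (1 - x') - s\<^sup>2 * (1 - Z)"
    unfolding assms by (simp add: algebra_simps)
qed

lemma cip_self_hol_coeff:
  assumes "cvec_norm a < 1"
  shows "a \<bullet>c a = 1 - (complex_of_real (hol_coeff a))\<^sup>2"
proof -
  have "(cvec_norm a)\<^sup>2 = 1 - (hol_coeff a)\<^sup>2"
    using hol_coeff(2)[OF assms] by simp
  then show ?thesis
    unfolding cip_self by simp
qed

text \<open>This is the classical identity \<open>1 - |\<phi> z|\<^sup>2 = (1 - |a|\<^sup>2) (1 -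
  |z|\<^sup>2) / |1 - \<langle>z, a\<rangle>|\<^sup>2\<close> with the denominator cleared;
  \<open>w\<close> is the numerator of the image.\<close>

lemma ball_invol_mem:
  assumes a: "a \<in> unit_ball n" and z: "z \<in> unit_ball n"
  shows "ball_invol a z \<in> unit_ball n"
proof -
  have ac: "a \<in> carrier_vec n" "cvec_norm a < 1" and zc: "z \<in> carrier_vec n" "cvec_norm z < 1"
    using a z by (auto simp: unit_ball_iff)
  define r where "r = hol_coeff a"
  define s where "s = complex_of_real r"
  define \<zeta> where "\<zeta> = z \<bullet>c a"
  have r: "r > 0" "r\<^sup>2 = 1 - (cvec_norm a)\<^sup>2"
    using hol_coeff[OF ac(2)] by (auto simp: r_def)
  have s: "1 + s \<noteq> 0" "cnj s = s"
  proof -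
    have "1 + s = of_real (1 + r)" by (simp add: s_def)
    then show "1 + s \<noteq> 0"
      using r(1) by (simp only: of_real_eq_0_iff)
  qed (use r(1) in \<open>simp add: s_def\<close>)
  have aa: "a \<bullet>c a = 1 - s\<^sup>2"
    using cip_self_hol_coeff[OF ac(2)] by (simp add: s_def r_def)
  have az: "a \<bullet>c z = cnj \<zeta>" "z \<bullet>c a = \<zeta>"
    using ac zc cnj_cip[of z a] by (auto simp: \<zeta>_def)
  define t where "t = 1 / (1 + s)"
  have t: "t * (1 + s) = 1" "cnj t = t"
    using s by (simp_all add: t_def)
  define w where "w = (1 - \<zeta> * t) \<cdot>\<^sub>v a - s \<cdot>\<^sub>v z"
  have "w \<bullet>c w = (1 - \<zeta> * t) * (1 - cnj \<zeta> * t) * (1 - s\<^sup>2)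
      - s * ((1 - \<zeta> * t) * cnj \<zeta> + (1 - cnj \<zeta> * t) * \<zeta>) + s\<^sup>2 * (z \<bullet>c z)"
    unfolding w_def using ac zc s(2) t(2)
    by (simp add: cip_linear aa az) (simp only: ring_distribs power2_eq_square mult_ac, simp)
  also have "\<dots> = (1 - \<zeta>) * (1 - cnj \<zeta>) - s\<^sup>2 * (1 - z \<bullet>c z)"
    by (rule ball_invol_identities(3)[OF t(1)])
  also have "\<dots> = of_real ((cmod (1 - \<zeta>))\<^sup>2 - r\<^sup>2 * (1 - (cvec_norm z)\<^sup>2))"
    unfolding cip_self by (simp add: complex_norm_square s_def del: of_real_power) simp
  finally have "(cvec_norm w)\<^sup>2 = (cmod (1 - \<zeta>))\<^sup>2 - r\<^sup>2 * (1 - (cvec_norm z)\<^sup>2)"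
    unfolding cip_self of_real_eq_iff .
  moreover have "r\<^sup>2 * (1 - (cvec_norm z)\<^sup>2) > 0"
    using r(1) zc by (intro mult_pos_pos) (simp_all add: power_less_one_iff)
  ultimately have "(cvec_norm w)\<^sup>2 < (cmod (1 - \<zeta>))\<^sup>2"
    by linarith
  then have "cvec_norm w < cmod (1 - \<zeta>)"
    by (rule power_less_imp_less_base) simp
  moreover have "1 - \<zeta> \<noteq> 0"
    using one_minus_cip_nonzero[OF a z] by (simp add: \<zeta>_def)
  moreover have "ball_invol a z = (1 / (1 - \<zeta>)) \<cdot>\<^sub>v w"
    unfolding ball_invol_eq[OF a zc(1)] by (simp add: w_def \<zeta>_def s_def r_def t_def)
  ultimately show ?thesis
    using ball_invol_carrier[OF a zc(1)] by (simp add: unit_ball_iff norm_divide divide_simps)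
qed

text \<open>At \<open>y = ball_invol a z\<close> the scalars
  \<open>1 - \<langle>y, a\<rangle>\<close> and \<open>1 - \<langle>y, a\<rangle> t\<close> are
  explicit multiples of \<open>1 / (1 - \<zeta>)\<close>. After substituting them the terms in
  \<open>a\<close> cancel and \<open>z\<close> remains.\<close>

lemma ball_invol_involution:
  assumes a: "a \<in> unit_ball n" and z: "z \<in> unit_ball n"
  shows "ball_invol a (ball_invol a z) = z"
proof -
  have ac: "a \<in> carrier_vec n" "cvec_norm a < 1" and zc: "z \<in> carrier_vec n" "cvec_norm z < 1"
    using a z by (auto simp: unit_ball_iff)
  define r where "r = hol_coeff a"
  define s where "s = complex_of_real r"
  define \<zeta> where "\<zeta> = z \<bullet>c a"
  have r: "r > 0" "r\<^sup>2 = 1 - (cvec_norm a)\<^sup>2"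
    using hol_coeff[OF ac(2)] by (auto simp: r_def)
  have s: "1 + s \<noteq> 0" "s \<noteq> 0"
  proof -
    have "1 + s = of_real (1 + r)" by (simp add: s_def)
    then show "1 + s \<noteq> 0"
      using r(1) by (simp only: of_real_eq_0_iff)
  qed (use r(1) in \<open>simp add: s_def\<close>)
  have aa: "a \<bullet>c a = 1 - s\<^sup>2"
    using cip_self_hol_coeff[OF ac(2)] by (simp add: s_def r_def)
  have \<zeta>: "1 - \<zeta> \<noteq> 0"
    using one_minus_cip_nonzero[OF a z] by (simp add: \<zeta>_def)
  define t where "t = 1 / (1 + s)"
  have t: "t * (1 + s) = 1"
    using s by (simp add: t_def)
  define y where "y = ball_invol a z"
  have y: "y = (1 / (1 - \<zeta>)) \<cdot>\<^sub>v ((1 - \<zeta> * t) \<cdot>\<^sub>v a - s \<cdot>\<^sub>v z)"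
    unfolding y_def ball_invol_eq[OF a zc(1)] by (simp add: \<zeta>_def s_def r_def t_def)
  have yc: "y \<in> carrier_vec n"
    unfolding y_def using ball_invol_carrier[OF a zc(1)] .
  have "y \<bullet>c a = (1 / (1 - \<zeta>)) * ((1 - \<zeta> * t) * (1 - s\<^sup>2) - s * \<zeta>)"
    unfolding y using ac zc by (simp add: cip_linear aa flip: \<zeta>_def)
  moreover have "(1 - \<zeta> * t) * (1 - s\<^sup>2) - s * \<zeta> = 1 - s\<^sup>2 - \<zeta>"
    by (rule ball_invol_identities(1)[OF t])
  ultimately have ya: "y \<bullet>c a = (1 - s\<^sup>2 - \<zeta>) / (1 - \<zeta>)"
    by simp
  have ya1: "1 - y \<bullet>c a = s\<^sup>2 / (1 - \<zeta>)"
    unfolding ya using \<zeta> by (simp add: divide_simps)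
  have "1 - \<zeta> - (1 - s\<^sup>2 - \<zeta>) * t = s * (1 - \<zeta> * t)"
    by (rule ball_invol_identities(2)[OF t])
  then have ya2: "1 - y \<bullet>c a * t = s * (1 - \<zeta> * t) / (1 - \<zeta>)"
    unfolding ya using \<zeta> by (simp add: field_simps)
  have "ball_invol a y = (1 / (1 - y \<bullet>c a)) \<cdot>\<^sub>v ((1 - y \<bullet>c a * t) \<cdot>\<^sub>v a - s \<cdot>\<^sub>v y)"
    unfolding ball_invol_eq[OF a yc] by (simp add: s_def r_def t_def)
  also have "\<dots> = z"
  proof (rule eq_vecI)
    fix i assume i: "i < dim_vec z"
    define p where "p = (1 - \<zeta> * t) * vec_index a i"
    have "vec_index ((1 / (1 - y \<bullet>c a)) \<cdot>\<^sub>v ((1 - y \<bullet>c a * t) \<cdot>\<^sub>v a - s \<cdot>\<^sub>v y)) i =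
      ((1 - \<zeta>) / s\<^sup>2) * (s / (1 - \<zeta>) * p - s * (1 / (1 - \<zeta>) * (p - s * vec_index z i)))"
      unfolding ya1 ya2 p_def using i zc ac by (simp add: y)
    also have "s / (1 - \<zeta>) * p - s * (1 / (1 - \<zeta>) * (p - s * vec_index z i)) =
        s\<^sup>2 * vec_index z i / (1 - \<zeta>)"
      by (simp add: right_diff_distrib diff_divide_distrib power2_eq_square)
    finally show "vec_index ((1 / (1 - y \<bullet>c a)) \<cdot>\<^sub>v ((1 - y \<bullet>c a * t) \<cdot>\<^sub>v a - s \<cdot>\<^sub>v y)) i
      = vec_index z i"
      using \<zeta> s(2) by simp
  qed (use yc ac zc in simp)
  finally show ?thesis by (simp add: y_def)
qed

lemma ball_invol_holomorphic:
  assumes a: "a \<in> unit_ball n"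
  shows "holomorphic_map_on n (unit_ball n) (ball_invol a)"
  unfolding holomorphic_map_on_iff
proof (intro ballI conjI)
  fix z assume z: "z \<in> unit_ball n"
  have ac: "a \<in> carrier_vec n" "cvec_norm a < 1" and zc: "z \<in> carrier_vec n" "cvec_norm z < 1"
    using a z by (auto simp: unit_ball_iff)
  show "ball_invol a z \<in> carrier_vec n"
    by (rule ball_invol_carrier[OF a zc(1)])
  define s where "s = complex_of_real (hol_coeff a)"
  define D where "D = 1 - z \<bullet>c a"
  have D: "D \<noteq> 0"
    using one_minus_cip_nonzero[OF a z] by (simp add: D_def)
  define L where "L = (1 - (1 - D) / (1 + s)) \<cdot>\<^sub>v a - s \<cdot>\<^sub>v z"
  have L: "L \<in> carrier_vec n" and phi: "ball_invol a z = (1 / D) \<cdot>\<^sub>v L"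
    unfolding L_def ball_invol_eq[OF a zc(1)] using ac zc by (auto simp: s_def D_def)
  \<comment> \<open>The quotient rule for \<open>L / D\<close>: an increment \<open>h\<close>
    changes \<open>D\<close> by \<open>- \<langle>h, a\<rangle>\<close> and \<open>L\<close> by
    \<open>- \<langle>h, a\<rangle> a / (1 + s) - s h\<close>. Collecting the multiples of
    \<open>\<langle>h, a\<rangle>\<close> gives \<open>v\<close>.\<close>
  define v where "v = (1 / D\<^sup>2) \<cdot>\<^sub>v L - (1 / (D * (1 + s))) \<cdot>\<^sub>v a"
  have v: "v \<in> carrier_vec n"
    unfolding v_def using L ac by simp
  obtain A where A: "A \<in> carrier_mat n n"
    and Ah: "\<And>h. h \<in> carrier_vec n \<Longrightarrow> A *\<^sub>v h = (h \<bullet>c a) \<cdot>\<^sub>v v + (- s / D) \<cdot>\<^sub>v h"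
    using rank_one_plus_scalar_mat[OF ac(1) v] by blast
  obtain C where C: "C > 0" "\<And>h. h \<in> carrier_vec n \<Longrightarrow> cvec_norm (A *\<^sub>v h) \<le> C * cvec_norm h"
    using mult_mat_vec_bounded[OF A] by blast
  \<comment> \<open>For this \<open>A\<close> the first-order remainder is exactly \<open>\<langle>h, a\<rangle> / (D - \<langle>h, a\<rangle>)\<close> times \<open>A h\<close>.\<close>
  have rem: "ball_invol a (z + h) - ball_invol a z - A *\<^sub>v h = ((h \<bullet>c a) / (D - h \<bullet>c a)) \<cdot>\<^sub>v (A *\<^sub>v h)"
    if h: "h \<in> carrier_vec n" and nz: "D - h \<bullet>c a \<noteq> 0" for h
  proof (rule eq_vecI)
    fix i assume "i < dim_vec (((h \<bullet>c a) / (D - h \<bullet>c a)) \<cdot>\<^sub>v (A *\<^sub>v h))"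
    then have i: "i < n" using A by simp
    define \<eta> where "\<eta> = h \<bullet>c a"
    have za: "(z + h) \<bullet>c a = 1 - D + \<eta>"
      using zc h ac by (simp add: cip_linear D_def \<eta>_def)
    have phih: "ball_invol a (z + h) =
        (1 / (D - \<eta>)) \<cdot>\<^sub>v ((1 - (1 - D + \<eta>) / (1 + s)) \<cdot>\<^sub>v a - s \<cdot>\<^sub>v (z + h))"
      using ball_invol_eq[OF a, of "z + h"] zc h unfolding za s_def by (simp add: algebra_simps)
    define t where "t = 1 / (1 + s)"
    define l where "l = vec_index L i"
    have l: "l = (1 - (1 - D) * t) * vec_index a i - s * vec_index z i"
      using i ac zc by (simp add: l_def L_def t_def)
    have Ai: "vec_index (A *\<^sub>v h) i =
        \<eta> * (l / D\<^sup>2 - t * vec_index a i / D) - s / D * vec_index h i"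
      unfolding Ah[OF h] using i L ac h by (simp add: v_def \<eta>_def l_def t_def field_simps)
    have "x / (1 + s) = x * t" for x
      by (simp add: t_def)
    then have "(1 - (1 - D + \<eta>) / (1 + s)) * vec_index a i - s * (vec_index z i + vec_index h i) =
        l - \<eta> * t * vec_index a i - s * vec_index h i"
      by (simp add: l algebra_simps)
    then have phihi: "vec_index (ball_invol a (z + h)) i =
        (l - \<eta> * t * vec_index a i - s * vec_index h i) / (D - \<eta>)"
      unfolding phih using i ac zc h by simp
    have "vec_index (ball_invol a (z + h) - ball_invol a z - A *\<^sub>v h) i =
       vec_index (ball_invol a (z + h)) i - vec_index (ball_invol a z) i - vec_index (A *\<^sub>v h) i"
      using i A L h by (simp add: phi)
    also have "\<dots> = (l - \<eta> * t * vec_index a i - s * vec_index h i) / (D - \<eta>) - l / D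
       - (\<eta> * (l / D\<^sup>2 - t * vec_index a i / D) - s / D * vec_index h i)"
      unfolding phihi Ai using i L by (simp add: phi l_def)
    also have "\<dots> = \<eta> / (D - \<eta>) *
        (\<eta> * (l / D\<^sup>2 - t * vec_index a i / D) - s / D * vec_index h i)"
      using D nz by (simp add: divide_simps \<eta>_def[symmetric]) (simp add: algebra_simps power2_eq_square)
    finally show "vec_index (ball_invol a (z + h) - ball_invol a z - A *\<^sub>v h) i =
        vec_index (((h \<bullet>c a) / (D - h \<bullet>c a)) \<cdot>\<^sub>v (A *\<^sub>v h)) i"
      using i A by (simp add: Ai \<eta>_def[symmetric] del: index_mult_mat_vec)
  qed (use A in simp)
  have "has_cderiv n (ball_invol a) z A"
  proof (rule has_cderivI[OF z A])
    fix e :: real assume e: "e > 0"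
    \<comment> \<open>The first bound keeps \<open>|D - \<langle>h, a\<rangle>|\<close> above
      \<open>|D| / 2\<close>; the second makes the factor of \<open>A h\<close> in the remainder at
      most \<open>e / C\<close>.\<close>
    define d where "d = min (cmod D / 2) (e * cmod D / (2 * C))"
    have d: "d > 0" using e D C by (simp add: d_def)
    show "\<exists>d>0. \<forall>h \<in> carrier_vec n. z + h \<in> unit_ball n \<longrightarrow> cvec_norm h < d \<longrightarrow>
      cvec_norm (ball_invol a (z + h) - ball_invol a z - A *\<^sub>v h) \<le> e * cvec_norm h"
    proof (intro exI[of _ d] conjI d ballI impI)
      fix h assume h: "h \<in> carrier_vec n" and hd: "cvec_norm h < d"
      have "cmod (h \<bullet>c a) \<le> cvec_norm h * cvec_norm a"
        using h ac by (intro cvec_Cauchy_Schwarz) auto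
      also have "\<dots> \<le> cvec_norm h"
        using ac(2) by (simp add: mult_left_le)
      finally have \<eta>: "cmod (h \<bullet>c a) < d"
        using hd by simp
      have "cmod D \<le> cmod (D - h \<bullet>c a) + cmod (h \<bullet>c a)"
        by (metis diff_add_cancel norm_triangle_ineq)
      then have low: "cmod (D - h \<bullet>c a) \<ge> cmod D / 2"
        using \<eta> unfolding d_def by linarith
      then have nz: "D - h \<bullet>c a \<noteq> 0"
        using D by (metis norm_zero half_gt_zero leD zero_less_norm_iff)
      have "cmod (h \<bullet>c a) * C \<le> (e * cmod D / (2 * C)) * C"
        using \<eta> C unfolding d_def by (intro mult_right_mono) auto
      also have "\<dots> = e * (cmod D / 2)" using C by simp
      also have "\<dots> \<le> e * cmod (D - h \<bullet>c a)"
        using low e by (intro mult_left_mono) auto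
      finally have "cmod (h \<bullet>c a) / cmod (D - h \<bullet>c a) * C \<le> e"
        using nz by (simp add: field_simps)
      then have "cmod (h \<bullet>c a) / cmod (D - h \<bullet>c a) * C * cvec_norm h \<le> e * cvec_norm h"
        by (intro mult_right_mono) auto
      moreover have "cmod (h \<bullet>c a) / cmod (D - h \<bullet>c a) * cvec_norm (A *\<^sub>v h) \<le>
          cmod (h \<bullet>c a) / cmod (D - h \<bullet>c a) * (C * cvec_norm h)"
        by (intro mult_left_mono C(2) h) auto
      ultimately show "cvec_norm (ball_invol a (z + h) - ball_invol a z - A *\<^sub>v h) \<le> e * cvec_norm h"
        unfolding rem[OF h nz] by (simp add: norm_divide)
    qed
  qed
  then show "\<exists>A. has_cderiv n (ball_invol a) z A" ..
qed

lemma ball_invol_Aut: "a \<in> unit_ball n \<Longrightarrow> ball_invol a \<in> Aut_ball n"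
  by (rule Aut_ballI[of n _ "ball_invol a"])
    (auto simp: ball_invol_mem ball_invol_involution ball_invol_holomorphic)

lemma ball_invol_zero_left:
  assumes "z \<in> carrier_vec n"
  shows "ball_invol (0\<^sub>v n) z = (- 1) \<cdot>\<^sub>v z"
proof -
  have "0\<^sub>v n \<in> unit_ball n" by (simp add: unit_ball_iff)
  from ball_invol_eq[OF this assms] show ?thesis
    using assms by (intro eq_vecI) (auto simp: hol_coeff_def)
qed

lemma ball_invol_self:
  assumes a: "a \<in> unit_ball n"
  shows "ball_invol a a = 0\<^sub>v n"
proof -
  have z: "0\<^sub>v n \<in> unit_ball n" by (simp add: unit_ball_iff)
  have "ball_invol a (0\<^sub>v n) = a"
    using ball_invol_eq[OF a, of "0\<^sub>v n"] a by (auto simp: unit_ball_iff intro!: eq_vecI)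
  then show ?thesis
    using ball_invol_involution[OF a z] by simp
qed

subsection \<open>Automorphisms fixing the origin\<close>

text \<open>The passage to one variable. The derivative at \<open>\<zeta>\<close> is
  \<open>\<langle>A u, v\<rangle>\<close> for the derivative \<open>A\<close> of \<open>f\<close> at
  \<open>\<zeta> u\<close>. The bound on \<open>u\<close> keeps the slice in the ball, and both
  bounds let the remainder estimate carry over with the same \<open>e\<close>.\<close>

lemma disc_slice_holomorphic:
  assumes f: "holomorphic_map_on n (unit_ball n) f"
    and u: "u \<in> carrier_vec n" "cvec_norm u \<le> 1" and v: "v \<in> carrier_vec n" "cvec_norm v \<le> 1"
  shows "(\<lambda>\<zeta>. f (\<zeta> \<cdot>\<^sub>v u) \<bullet>c v) holomorphic_on ball 0 1"
proof -
  let ?F = "\<lambda>\<zeta>. f (\<zeta> \<cdot>\<^sub>v u) \<bullet>c v"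
  have mem: "\<zeta> \<cdot>\<^sub>v u \<in> unit_ball n" if "cmod \<zeta> < 1" for \<zeta>
    using that u mult_left_le[of "cvec_norm u" "cmod \<zeta>"] by (simp add: unit_ball_iff)
  have "?F field_differentiable (at \<zeta>)" if \<zeta>: "cmod \<zeta> < 1" for \<zeta>
  proof -
    obtain A where A: "has_cderiv n f (\<zeta> \<cdot>\<^sub>v u) A"
      using f mem[OF \<zeta>] unfolding holomorphic_map_on_iff by blast
    note Ac = has_cderiv_carrier[OF A]
    define c where "c = (A *\<^sub>v u) \<bullet>c v"
    have "(?F has_derivative (*) c) (at \<zeta>)"
      unfolding has_derivative_at_alt
    proof (intro conjI allI impI)
      show "bounded_linear ((*) c)" by (rule bounded_linear_mult_right)
      fix e :: real assume "e > 0"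
      then obtain d where d: "d > 0" "\<And>h. h \<in> carrier_vec n \<Longrightarrow> cvec_norm h < d \<Longrightarrow>
          cvec_norm (f (\<zeta> \<cdot>\<^sub>v u + h) - f (\<zeta> \<cdot>\<^sub>v u) - A *\<^sub>v h) \<le> e * cvec_norm h"
        using has_cderivD[OF A] by blast
      show "\<exists>d>0. \<forall>y. cmod (y - \<zeta>) < d \<longrightarrow>
          cmod (?F y - ?F \<zeta> - c * (y - \<zeta>)) \<le> e * cmod (y - \<zeta>)"
      proof (intro exI[of _ "min d (1 - cmod \<zeta>)"] conjI allI impI)
        show "0 < min d (1 - cmod \<zeta>)" using d \<zeta> by simp
        fix y assume y: "cmod (y - \<zeta>) < min d (1 - cmod \<zeta>)"
        have y1: "cmod y < 1"
          using y norm_triangle_ineq[of "y - \<zeta>" \<zeta>] by simp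
        define h where "h = (y - \<zeta>) \<cdot>\<^sub>v u"
        have h: "h \<in> carrier_vec n" "cvec_norm h \<le> cmod (y - \<zeta>)"
          using u mult_left_le[of "cvec_norm u" "cmod (y - \<zeta>)"] by (auto simp: h_def)
        have yu: "\<zeta> \<cdot>\<^sub>v u + h = y \<cdot>\<^sub>v u"
          by (intro eq_vecI) (auto simp: h_def algebra_simps)
        define r where "r = f (y \<cdot>\<^sub>v u) - f (\<zeta> \<cdot>\<^sub>v u) - A *\<^sub>v h"
        have fc: "f (y \<cdot>\<^sub>v u) \<in> carrier_vec n" "f (\<zeta> \<cdot>\<^sub>v u) \<in> carrier_vec n"
          using f mem[OF y1] mem[OF \<zeta>] unfolding holomorphic_map_on_iff by auto
        have Au: "A *\<^sub>v u \<in> carrier_vec n" using Ac u by simp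
        have Ah: "A *\<^sub>v h = (y - \<zeta>) \<cdot>\<^sub>v (A *\<^sub>v u)"
          unfolding h_def using Ac u by (simp add: mult_mat_vec)
        have rc: "r \<in> carrier_vec n"
          unfolding r_def Ah using fc Au by auto
        have "?F y - ?F \<zeta> - c * (y - \<zeta>) = r \<bullet>c v"
          unfolding r_def Ah c_def
          using carrier_vecD[OF fc(1)] carrier_vecD[OF fc(2)] carrier_vecD[OF Au] carrier_vecD[OF v(1)]
          by (simp add: cip_linear del: dim_mult_mat_vec)
        then have "cmod (?F y - ?F \<zeta> - c * (y - \<zeta>)) \<le> cvec_norm r * cvec_norm v"
          using cvec_Cauchy_Schwarz[of r v] rc v by simp
        also have "\<dots> \<le> cvec_norm r"
          using v by (intro mult_left_le) auto
        also have "\<dots> \<le> e * cvec_norm h"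
          using d(2)[OF h(1)] h(2) y unfolding yu r_def by simp
        also have "\<dots> \<le> e * cmod (y - \<zeta>)"
          using h \<open>e > 0\<close> by simp
        finally show "cmod (?F y - ?F \<zeta> - c * (y - \<zeta>)) \<le> e * cmod (y - \<zeta>)" .
      qed
    qed
    then have "(?F has_field_derivative c) (at \<zeta>)"
      by (simp add: has_field_derivative_def)
    then show ?thesis
      by (auto simp: field_differentiable_def)
  qed
  then show ?thesis
    by (auto simp: holomorphic_on_def intro: field_differentiable_at_within)
qed

text \<open>With \<open>v\<close> pointing along \<open>f z\<close>, the slice takes the value
  \<open>|f z|\<close> at the parameter \<open>|z|\<close>, so the scalar Schwarz lemma gives the
  inequality. In the case of equality the slice is a rotation, and it fixes the positive number
  \<open>|z|\<close>, hence is the identity.\<close>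

lemma schwarz_slice:
  assumes f: "holomorphic_map_on n (unit_ball n) f" and fU: "f ` unit_ball n \<subseteq> unit_ball n"
    and f0: "f (0\<^sub>v n) = 0\<^sub>v n"
    and z: "z \<in> unit_ball n" "z \<noteq> 0\<^sub>v n" and fz: "f z \<noteq> 0\<^sub>v n"
  defines "u \<equiv> complex_of_real (1 / cvec_norm z) \<cdot>\<^sub>v z"
    and "v \<equiv> complex_of_real (1 / cvec_norm (f z)) \<cdot>\<^sub>v f z"
  shows "cvec_norm (f z) \<le> cvec_norm z"
    and "cvec_norm (f z) = cvec_norm z \<Longrightarrow> cmod \<zeta> < 1 \<Longrightarrow> f (\<zeta> \<cdot>\<^sub>v u) \<bullet>c v = \<zeta>"
proof -
  let ?F = "\<lambda>\<zeta>. f (\<zeta> \<cdot>\<^sub>v u) \<bullet>c v"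
  have zc: "z \<in> carrier_vec n" "cvec_norm z < 1"
    using z by (auto simp: unit_ball_iff)
  have fzc: "f z \<in> carrier_vec n"
    using z fU unit_ball_carrier[of "f z" n] by (simp add: image_subset_iff)
  have nz: "cvec_norm z > 0" and nfz: "cvec_norm (f z) > 0"
    using z fz zc fzc cvec_norm_eq_0_iff[of z] cvec_norm_eq_0_iff[of "f z"]
    by (auto simp: less_le)
  have u: "u \<in> carrier_vec n" "cvec_norm u = 1" and v: "v \<in> carrier_vec n" "cvec_norm v = 1"
    using zc fzc nz nfz by (auto simp: u_def v_def norm_divide)
  have hol: "?F holomorphic_on ball 0 1"
    using u v by (intro disc_slice_holomorphic[OF f]) auto
  have F0: "?F 0 = 0"
  proof -
    have "0 \<cdot>\<^sub>v u = 0\<^sub>v n" using u by (intro eq_vecI) auto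
    then show ?thesis using f0 v by simp
  qed
  have Flt: "cmod (?F \<xi>) < 1" if "cmod \<xi> < 1" for \<xi>
  proof -
    have "\<xi> \<cdot>\<^sub>v u \<in> unit_ball n" using that u by (simp add: unit_ball_iff)
    then have "f (\<xi> \<cdot>\<^sub>v u) \<in> unit_ball n" using fU by blast
    then show ?thesis
      using cvec_Cauchy_Schwarz[of "f (\<xi> \<cdot>\<^sub>v u)" v] v by (simp add: unit_ball_iff)
  qed
  define \<rho> where "\<rho> = complex_of_real (cvec_norm z)"
  have \<rho>: "cmod \<rho> < 1" "\<rho> \<noteq> 0" "cmod \<rho> = cvec_norm z"
    using nz zc by (auto simp: \<rho>_def)
  have "\<rho> \<cdot>\<^sub>v u = z"
    using nz by (intro eq_vecI) (auto simp: \<rho>_def u_def)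
  then have F\<rho>: "?F \<rho> = complex_of_real (cvec_norm (f z))"
    using nfz fzc by (simp add: v_def cip_smult_right cip_self power2_eq_square)
  show "cvec_norm (f z) \<le> cvec_norm z"
    using Schwarz_Lemma(1)[OF hol F0 Flt \<rho>(1)] F\<rho> \<rho>(3) by simp
  assume eq: "cvec_norm (f z) = cvec_norm z" and \<zeta>: "cmod \<zeta> < 1"
  have "cmod (?F \<rho>) = cmod \<rho>"
    using F\<rho> \<rho>(3) eq by simp
  then obtain \<alpha> where \<alpha>: "\<And>\<xi>. cmod \<xi> < 1 \<Longrightarrow> ?F \<xi> = \<alpha> * \<xi>"
    using Schwarz_Lemma(3)[OF hol F0 Flt \<rho>(1)] \<rho> by blast
  have "\<alpha> * \<rho> = \<rho>"
    using \<alpha>[OF \<rho>(1)] F\<rho> eq by (simp add: \<rho>_def)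
  then have "\<alpha> = 1" using \<rho> by simp
  then show "?F \<zeta> = \<zeta>" using \<alpha>[OF \<zeta>] by simp
qed

text \<open>The Schwarz inequality holds for \<open>f\<close> and for its inverse, and the two are
  opposite.\<close>

lemma Aut_fixing_zero_norm:
  assumes f: "f \<in> Aut_ball n" and f0: "f (0\<^sub>v n) = 0\<^sub>v n" and z: "z \<in> unit_ball n"
  shows "cvec_norm (f z) = cvec_norm z"
proof -
  have zero: "0\<^sub>v n \<in> unit_ball n" by (simp add: unit_ball_iff)
  obtain g where g: "\<And>z. z \<in> unit_ball n \<Longrightarrow> f z \<in> unit_ball n"
    "\<And>z. z \<in> unit_ball n \<Longrightarrow> g z \<in> unit_ball n"
    "\<And>z. z \<in> unit_ball n \<Longrightarrow> g (f z) = z" "\<And>z. z \<in> unit_ball n \<Longrightarrow> f (g z) = z"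
    "holomorphic_map_on n (unit_ball n) f" "holomorphic_map_on n (unit_ball n) g"
    using Aut_ballE[OF f] by blast
  have g0: "g (0\<^sub>v n) = 0\<^sub>v n" using g(3)[OF zero] f0 by simp
  show ?thesis
  proof (cases "z = 0\<^sub>v n")
    case False
    then have fz: "f z \<noteq> 0\<^sub>v n" using g(3)[OF z] g0 by auto
    have "cvec_norm (f z) \<le> cvec_norm z"
      by (rule schwarz_slice(1)[OF g(5) _ f0 z False fz]) (use g in auto)
    moreover have "cvec_norm (g (f z)) \<le> cvec_norm (f z)"
      by (rule schwarz_slice(1)[OF g(6) _ g0 g(1)[OF z] fz]) (use g z False in auto)
    ultimately show ?thesis using g(3)[OF z] by simp
  qed (use f0 in simp)
qed

lemma cvec_norm_scale_into_ball:
  obtains c :: real where "c > 0" "c * cvec_norm z < 1"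
proof (rule that)
  show "1 / (cvec_norm z + 1) > 0" "1 / (cvec_norm z + 1) * cvec_norm z < 1"
    using cvec_norm_nonneg[of z] by (auto simp: field_simps add_pos_nonneg)
qed

text \<open>Cartan's theorem for the ball: the case of equality in the Schwarz lemma on each disc
  through the origin forces \<open>f\<close> to agree with its derivative at \<open>0\<close>.\<close>

lemma Aut_fixing_zero_linear:
  assumes f: "f \<in> Aut_ball n" and f0: "f (0\<^sub>v n) = 0\<^sub>v n"
  obtains A where "A \<in> carrier_mat n n" "\<And>z. z \<in> unit_ball n \<Longrightarrow> f z = A *\<^sub>v z"
    "\<And>z. z \<in> carrier_vec n \<Longrightarrow> cvec_norm (A *\<^sub>v z) = cvec_norm z"
proof -
  have zero: "0\<^sub>v n \<in> unit_ball n" by (simp add: unit_ball_iff)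
  have hol: "holomorphic_map_on n (unit_ball n) f" and fU: "f ` unit_ball n \<subseteq> unit_ball n"
    using Aut_ballE[OF f] by blast+
  obtain A where A: "has_cderiv n f (0\<^sub>v n) A"
    using hol zero unfolding holomorphic_map_on_iff by blast
  note Ac = has_cderiv_carrier[OF A]
  have lin: "f z = A *\<^sub>v z" if z: "z \<in> unit_ball n" for z
  proof (cases "z = 0\<^sub>v n")
    case True
    have "A *\<^sub>v 0\<^sub>v n = 0\<^sub>v n" using Ac by (intro eq_vecI) auto
    then show ?thesis using True f0 by simp
  next
    case False
    have zc: "z \<in> carrier_vec n" "cvec_norm z < 1"
      using z by (auto simp: unit_ball_iff)
    have fzc: "f z \<in> carrier_vec n"
      using z fU unit_ball_carrier[of "f z" n] by (simp add: image_subset_iff)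
    have eq: "cvec_norm (f z) = cvec_norm z"
      by (rule Aut_fixing_zero_norm[OF f f0 z])
    have nz: "cvec_norm z > 0"
      using False zc cvec_norm_eq_0_iff[of z] by (auto simp: less_le)
    then have fz: "f z \<noteq> 0\<^sub>v n" using eq by auto
    define u where "u = complex_of_real (1 / cvec_norm z) \<cdot>\<^sub>v z"
    define v where "v = complex_of_real (1 / cvec_norm (f z)) \<cdot>\<^sub>v f z"
    have u: "u \<in> carrier_vec n" "cvec_norm u = 1" and v: "v \<in> carrier_vec n" "cvec_norm v = 1"
      using zc fzc nz eq by (auto simp: u_def v_def norm_divide)
    have disc: "f (\<zeta> \<cdot>\<^sub>v u) = \<zeta> \<cdot>\<^sub>v v" if \<zeta>: "cmod \<zeta> < 1" for \<zeta>
    proof -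
      define w where "w = f (\<zeta> \<cdot>\<^sub>v u)"
      have mem: "\<zeta> \<cdot>\<^sub>v u \<in> unit_ball n" using \<zeta> u by (simp add: unit_ball_iff)
      then have "w \<in> unit_ball n"
        using fU by (simp add: w_def image_subset_iff)
      then have w: "w \<in> carrier_vec n" "cvec_norm w = cmod \<zeta>"
        using Aut_fixing_zero_norm[OF f f0 mem] u by (auto simp: w_def unit_ball_iff)
      have wv: "w \<bullet>c v = \<zeta>"
        unfolding w_def u_def v_def
        by (rule schwarz_slice(2)[OF hol fU f0 z False fz eq \<zeta>])
      then have vw: "v \<bullet>c w = cnj \<zeta>"
        using cnj_cip[of w v] w v by simp
      have ww: "w \<bullet>c w = \<zeta> * cnj \<zeta>" "v \<bullet>c v = 1"
        unfolding cip_self w(2) v(2) by (simp_all only: complex_norm_square) simp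
      \<comment> \<open>\<open>|w| = |\<zeta>|\<close> and
        \<open>\<langle>w, v\<rangle> = \<zeta>\<close> with \<open>v\<close> a unit vector:
        equality in Cauchy-Schwarz, so \<open>w\<close> is its own projection onto
        \<open>v\<close>.\<close>
      have "(w - \<zeta> \<cdot>\<^sub>v v) \<bullet>c (w - \<zeta> \<cdot>\<^sub>v v) = 0"
        using w v by (simp add: cip_linear wv vw ww)
      then have "cvec_norm (w - \<zeta> \<cdot>\<^sub>v v) = 0"
        by (simp add: cvec_norm_def)
      then have wz: "w - \<zeta> \<cdot>\<^sub>v v = 0\<^sub>v n"
        using w v by (simp add: cvec_norm_eq_0_iff)
      show ?thesis
        unfolding w_def[symmetric]
      proof (rule eq_vecI)
        fix i assume i: "i < dim_vec (\<zeta> \<cdot>\<^sub>v v)"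
        then have "vec_index (w - \<zeta> \<cdot>\<^sub>v v) i = 0"
          unfolding wz using v by simp
        then show "vec_index w i = vec_index (\<zeta> \<cdot>\<^sub>v v) i"
          using i w v by simp
      qed (use w v in simp)
    qed
    have Au: "A *\<^sub>v u \<in> carrier_vec n" using Ac u by simp
    \<comment> \<open>Along \<open>u\<close> the difference quotient of \<open>f\<close> at 0 is
      constantly \<open>v\<close>, so the derivative sends \<open>u\<close> to \<open>v\<close>. A
      single small real \<open>t\<close> shows this up to \<open>e\<close>.\<close>
    have "cvec_norm (v - A *\<^sub>v u) \<le> 0 + e" if e: "e > 0" for e
    proof -
      obtain d where d: "d > 0" "\<And>h. h \<in> carrier_vec n \<Longrightarrow> cvec_norm h < d \<Longrightarrow>
          cvec_norm (f (0\<^sub>v n + h) - f (0\<^sub>v n) - A *\<^sub>v h) \<le> e * cvec_norm h"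
        using has_cderivD[OF A e] by blast
      define t where "t = min (d / 2) (1 / 2)"
      have t: "t > 0" "t < d" "t < 1" using d by (auto simp: t_def)
      define h where "h = complex_of_real t \<cdot>\<^sub>v u"
      have h: "h \<in> carrier_vec n" "cvec_norm h = t"
        using u t by (auto simp: h_def)
      have fh: "f h = complex_of_real t \<cdot>\<^sub>v v"
        unfolding h_def using t by (intro disc) auto
      have "A *\<^sub>v h = complex_of_real t \<cdot>\<^sub>v (A *\<^sub>v u)"
        unfolding h_def using Ac u by (simp add: mult_mat_vec)
      then have "f (0\<^sub>v n + h) - f (0\<^sub>v n) - A *\<^sub>v h = complex_of_real t \<cdot>\<^sub>v (v - A *\<^sub>v u)"
        using h fh f0 v Au Ac by (intro eq_vecI) (auto simp: right_diff_distrib simp del: index_mult_mat_vec)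
      then have "t * cvec_norm (v - A *\<^sub>v u) \<le> e * t"
        using d(2)[OF h(1)] h t by simp
      then show ?thesis using t by simp
    qed
    then have "cvec_norm (v - A *\<^sub>v u) \<le> 0"
      by (rule field_le_epsilon)
    then have "cvec_norm (v - A *\<^sub>v u) = 0"
      by (simp add: order_antisym)
    then have vAu: "v - A *\<^sub>v u = 0\<^sub>v n"
      using Au by (simp add: cvec_norm_eq_0_iff del: dim_mult_mat_vec)
    have zu: "z = complex_of_real (cvec_norm z) \<cdot>\<^sub>v u"
      using nz by (intro eq_vecI) (auto simp: u_def)
    have fv: "f z = complex_of_real (cvec_norm z) \<cdot>\<^sub>v v"
      using nz eq by (intro eq_vecI) (auto simp: v_def)
    have Az: "A *\<^sub>v z = complex_of_real (cvec_norm z) \<cdot>\<^sub>v (A *\<^sub>v u)"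
      by (subst zu, rule mult_mat_vec[OF Ac u(1)])
    have "v = A *\<^sub>v u"
    proof (rule eq_vecI)
      fix i assume i: "i < dim_vec (A *\<^sub>v u)"
      then have "vec_index (v - A *\<^sub>v u) i = 0"
        unfolding vAu using Ac by simp
      then show "vec_index v i = vec_index (A *\<^sub>v u) i"
        using i by simp
    qed (use v Ac in simp)
    then show ?thesis using fv Az by simp
  qed
  \<comment> \<open>The preservation of norms is known on the ball only; a small multiple of
    \<open>z\<close> lies there, and both sides are homogeneous.\<close>
  have nrm: "cvec_norm (A *\<^sub>v z) = cvec_norm z" if z: "z \<in> carrier_vec n" for z
  proof -
    obtain c where c: "c > 0" "c * cvec_norm z < 1"
      by (rule cvec_norm_scale_into_ball)
    define y where "y = complex_of_real c \<cdot>\<^sub>v z"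
    have y: "y \<in> unit_ball n" "cvec_norm y = c * cvec_norm z"
      using z c by (auto simp: y_def unit_ball_iff)
    have "cvec_norm (f y) = cvec_norm y"
      by (rule Aut_fixing_zero_norm[OF f f0 y(1)])
    then have "cvec_norm (A *\<^sub>v y) = c * cvec_norm z"
      using lin[OF y(1)] y by simp
    moreover have "A *\<^sub>v y = complex_of_real c \<cdot>\<^sub>v (A *\<^sub>v z)"
      unfolding y_def using Ac z by (simp add: mult_mat_vec)
    ultimately show ?thesis using c by simp
  qed
  show thesis using that Ac lin nrm by blast
qed

text \<open>Polarization: comparing the norms of \<open>u + c v\<close> and of its image for
  \<open>c = 1\<close> gives the real parts, for \<open>c = \<i>\<close> the imaginary
  parts.\<close>

lemma isometric_mat_cip:
  assumes A: "A \<in> carrier_mat n n"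
    and nrm: "\<And>z. z \<in> carrier_vec n \<Longrightarrow> cvec_norm (A *\<^sub>v z) = cvec_norm z"
    and u: "u \<in> carrier_vec n" and v: "v \<in> carrier_vec n"
  shows "(A *\<^sub>v u) \<bullet>c (A *\<^sub>v v) = u \<bullet>c v"
proof -
  define a b where "a = A *\<^sub>v u" and "b = A *\<^sub>v v"
  have ab: "a \<in> carrier_vec n" "b \<in> carrier_vec n"
    using A u v by (auto simp: a_def b_def)
  have self: "a \<bullet>c a = u \<bullet>c u" "b \<bullet>c b = v \<bullet>c v"
    unfolding cip_self a_def b_def using nrm u v by simp_all
  have *: "cnj c * (a \<bullet>c b) + c * cnj (a \<bullet>c b) = cnj c * (u \<bullet>c v) + c * cnj (u \<bullet>c v)" for c
  proof -
    have "A *\<^sub>v (u + c \<cdot>\<^sub>v v) = a + c \<cdot>\<^sub>v b"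
      unfolding a_def b_def using A u v
      by (simp add: mult_add_distrib_mat_vec[of _ n n] mult_mat_vec[of _ n n])
    then have "(a + c \<cdot>\<^sub>v b) \<bullet>c (a + c \<cdot>\<^sub>v b) = (u + c \<cdot>\<^sub>v v) \<bullet>c (u + c \<cdot>\<^sub>v v)"
      unfolding cip_self using nrm[of "u + c \<cdot>\<^sub>v v"] u v by simp
    moreover have "b \<bullet>c a = cnj (a \<bullet>c b)" "v \<bullet>c u = cnj (u \<bullet>c v)"
      using ab u v by (simp_all add: cnj_cip)
    ultimately show ?thesis
      using ab u v self by (simp add: cip_linear) (simp add: algebra_simps)
  qed
  show ?thesis
    using *[of 1] *[of \<i>] by (simp add: complex_eq_iff a_def b_def)
qed

lemma kos_eq:
  assumes "x \<in> unit_ball n" "y \<in> unit_ball n" "z \<in> unit_ball n"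
  shows "kos x y z = (ball_invol x y \<bullet>c ball_invol x z) /
    of_real (pseudohyp_dist x y * pseudohyp_dist x z)"
proof -
  have "dim_vec (ball_invol x y) = n" "dim_vec (ball_invol x z) = n"
    using assms ball_invol_carrier[OF assms(1)] unit_ball_carrier by (auto dest!: carrier_vecD)
  then show ?thesis
    by (simp add: kos_def pseudohyp_dist_def cip_linear)
qed

lemma Aut_invariance:
  assumes g: "g \<in> Aut_ball n" and x: "x \<in> unit_ball n" and y: "y \<in> unit_ball n" and z: "z \<in> unit_ball n"
  shows "ball_invol (g x) (g y) \<bullet>c ball_invol (g x) (g z) = ball_invol x y \<bullet>c ball_invol x z"
proof -
  have gU: "g w \<in> unit_ball n" if "w \<in> unit_ball n" for w
    using that g Aut_ballE by blast
  have zero: "0\<^sub>v n \<in> unit_ball n" by (simp add: unit_ball_iff)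
  have x0: "ball_invol x (0\<^sub>v n) = x"
    using ball_invol_involution[OF x x] by (simp add: ball_invol_self[OF x])
  \<comment> \<open>Since \<open>ball_invol x\<close> is an involution, \<open>h\<close> takes
    \<open>ball_invol x w\<close> to \<open>ball_invol (g x) (g w)\<close>. One linear isometry thus
    serves \<open>y\<close> and \<open>z\<close> simultaneously.\<close>
  define h where "h = ball_invol (g x) \<circ> (g \<circ> ball_invol x)"
  have "h \<in> Aut_ball n"
    unfolding h_def by (intro Aut_ball_compose ball_invol_Aut g gU x)
  moreover have "h (0\<^sub>v n) = 0\<^sub>v n"
    by (simp add: h_def x0 ball_invol_self gU x)
  ultimately obtain A where A: "A \<in> carrier_mat n n" "\<And>z. z \<in> unit_ball n \<Longrightarrow> h z = A *\<^sub>v z"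
    "\<And>z. z \<in> carrier_vec n \<Longrightarrow> cvec_norm (A *\<^sub>v z) = cvec_norm z"
    using Aut_fixing_zero_linear by blast
  have "ball_invol (g x) (g w) = A *\<^sub>v ball_invol x w" if w: "w \<in> unit_ball n" for w
    using A(2)[OF ball_invol_mem[OF x w]] by (simp add: h_def ball_invol_involution[OF x w])
  then show ?thesis
    using y z isometric_mat_cip[OF A(1,3)] ball_invol_carrier[OF x] by (simp add: unit_ball_iff)
qed

lemma kos_Aut:
  assumes g: "g \<in> Aut_ball n" and x: "x \<in> unit_ball n" and y: "y \<in> unit_ball n" and z: "z \<in> unit_ball n"
  shows "kos (g x) (g y) (g z) = kos x y z"
proof -
  have gU: "g w \<in> unit_ball n" if "w \<in> unit_ball n" for w
    using that g Aut_ballE by blast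
  have "pseudohyp_dist (g x) (g w) = pseudohyp_dist x w" if "w \<in> unit_ball n" for w
    unfolding pseudohyp_dist_def using Aut_invariance[OF g x that that] by (rule cvec_norm_eqI)
  then show ?thesis
    using assms by (simp add: kos_eq[of _ n] gU Aut_invariance[OF g x y z])
qed

subsection \<open>Unitary maps\<close>

text \<open>An isometry together with a linear inverse: the inverse supplies the holomorphic inverse
  that an automorphism of the ball requires.\<close>

definition unitary_mat :: "nat \<Rightarrow> complex mat \<Rightarrow> bool" where
  "unitary_mat n A \<longleftrightarrow> A \<in> carrier_mat n n \<and>
     (\<forall>z \<in> carrier_vec n. cvec_norm (A *\<^sub>v z) = cvec_norm z) \<and>
     (\<exists>B \<in> carrier_mat n n. \<forall>z \<in> carrier_vec n. B *\<^sub>v (A *\<^sub>v z) = z \<and> A *\<^sub>v (B *\<^sub>v z) = z)"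

lemma unitary_mat_Aut:
  assumes "unitary_mat n A"
  shows "(\<lambda>z. A *\<^sub>v z) \<in> Aut_ball n"
proof -
  from assms obtain B where A: "A \<in> carrier_mat n n" and B: "B \<in> carrier_mat n n"
    and nA: "\<And>z. z \<in> carrier_vec n \<Longrightarrow> cvec_norm (A *\<^sub>v z) = cvec_norm z"
    and BA: "\<And>z. z \<in> carrier_vec n \<Longrightarrow> B *\<^sub>v (A *\<^sub>v z) = z"
    and AB: "\<And>z. z \<in> carrier_vec n \<Longrightarrow> A *\<^sub>v (B *\<^sub>v z) = z"
    unfolding unitary_mat_def by blast
  have nB: "cvec_norm (B *\<^sub>v z) = cvec_norm z" if "z \<in> carrier_vec n" for z
    using nA[of "B *\<^sub>v z"] AB[OF that] B that by simp
  show ?thesis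
    by (rule Aut_ballI[of n _ "\<lambda>z. B *\<^sub>v z"])
      (use A B in \<open>auto simp: unit_ball_iff nA nB BA AB simp del: assoc_mult_mat_vec
        intro: holomorphic_linear\<close>)
qed

lemma unitary_mat_mult:
  assumes "unitary_mat n A" "unitary_mat n B"
  shows "unitary_mat n (B * A)"
proof -
  from assms(1) obtain A' where A: "A \<in> carrier_mat n n" "A' \<in> carrier_mat n n"
    and nA: "\<And>z. z \<in> carrier_vec n \<Longrightarrow> cvec_norm (A *\<^sub>v z) = cvec_norm z"
    and iA: "\<And>z. z \<in> carrier_vec n \<Longrightarrow> A' *\<^sub>v (A *\<^sub>v z) = z"
     "\<And>z. z \<in> carrier_vec n \<Longrightarrow> A *\<^sub>v (A' *\<^sub>v z) = z"
    unfolding unitary_mat_def by blast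
  from assms(2) obtain B' where B: "B \<in> carrier_mat n n" "B' \<in> carrier_mat n n"
    and nB: "\<And>z. z \<in> carrier_vec n \<Longrightarrow> cvec_norm (B *\<^sub>v z) = cvec_norm z"
    and iB: "\<And>z. z \<in> carrier_vec n \<Longrightarrow> B' *\<^sub>v (B *\<^sub>v z) = z"
     "\<And>z. z \<in> carrier_vec n \<Longrightarrow> B *\<^sub>v (B' *\<^sub>v z) = z"
    unfolding unitary_mat_def by blast
  have BA: "(B * A) *\<^sub>v z = B *\<^sub>v (A *\<^sub>v z)" if "z \<in> carrier_vec n" for z
    using A B that by (intro assoc_mult_mat_vec)
  have AB': "(A' * B') *\<^sub>v z = A' *\<^sub>v (B' *\<^sub>v z)" if "z \<in> carrier_vec n" for z
    using A B that by (intro assoc_mult_mat_vec)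
  have car: "C *\<^sub>v z \<in> carrier_vec n" if "C \<in> carrier_mat n n" "z \<in> carrier_vec n" for C z
    using that by simp
  show ?thesis
    unfolding unitary_mat_def
  proof (intro conjI ballI bexI[of _ "A' * B'"])
    fix z :: "complex vec" assume z: "z \<in> carrier_vec n"
    show "cvec_norm (B * A *\<^sub>v z) = cvec_norm z"
      unfolding BA[OF z] by (simp only: nB nA car A B z)
    show "A' * B' *\<^sub>v (B * A *\<^sub>v z) = z"
      unfolding BA[OF z] by (simp only: AB' iA iB car A B z)
    show "B * A *\<^sub>v (A' * B' *\<^sub>v z) = z"
      unfolding AB'[OF z] by (simp only: BA iA iB car A B z)
  qed (use A B in auto)
qed

lemma unitary_mat_cip:
  assumes "unitary_mat n A" "u \<in> carrier_vec n" "v \<in> carrier_vec n"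
  shows "(A *\<^sub>v u) \<bullet>c (A *\<^sub>v v) = u \<bullet>c v"
  using assms isometric_mat_cip[of A n u v] by (auto simp: unitary_mat_def)

text \<open>A complex Householder map \<open>x \<mapsto> x - c \<langle>x, w\<rangle> w\<close> with \<open>w = p - q\<close>; the coefficient
  \<open>c = 1 / \<langle>p, w\<rangle>\<close> is forced by \<open>p \<mapsto> q\<close>, and \<open>|p| = |q|\<close> makes the map unitary.\<close>

lemma unitary_mat_moving:
  assumes p: "p \<in> carrier_vec n" and q: "q \<in> carrier_vec n" and pq: "cvec_norm p = cvec_norm q"
  obtains A where "unitary_mat n A" "A *\<^sub>v p = q"
    "\<And>x. x \<in> carrier_vec n \<Longrightarrow> x \<bullet>c p = x \<bullet>c q \<Longrightarrow> A *\<^sub>v x = x"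
proof (cases "p = q")
  case True
  have "unitary_mat n (1\<^sub>m n)"
    unfolding unitary_mat_def by (auto intro!: bexI[of _ "1\<^sub>m n"])
  then show thesis
    by (rule that) (use True p in auto)
next
  case False
  define w where "w = p - q"
  have w: "w \<in> carrier_vec n" using p q by (simp add: w_def)
  define k where "k = p \<bullet>c w"
  define W where "W = w \<bullet>c w"
  have ppqq: "p \<bullet>c p = q \<bullet>c q"
    unfolding cip_self pq by simp
  have qp: "q \<bullet>c p = cnj (p \<bullet>c q)"
    using p q by (simp add: cnj_cip)
  \<comment> \<open>From \<open>|p| = |q|\<close> the squared length of \<open>w = p - q\<close> is
    twice the real part of \<open>\<langle>p, w\<rangle>\<close>. As \<open>p \<noteq> q\<close>,
    this makes \<open>k\<close> nonzero.\<close>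
  have kW: "k + cnj k = W"
  proof -
    have "cnj k = w \<bullet>c p" using p w by (simp add: k_def cnj_cip)
    then show ?thesis
      unfolding k_def W_def w_def using p q ppqq by (simp add: cip_linear)
  qed
  have "W \<noteq> 0"
  proof
    assume "W = 0"
    then have "cvec_norm w = 0" by (simp add: W_def cvec_norm_def)
    then have w0: "w = 0\<^sub>v n" using w by (simp add: cvec_norm_eq_0_iff)
    have "p = q"
    proof (rule eq_vecI)
      fix i assume i: "i < dim_vec q"
      then have "vec_index w i = 0" unfolding w0 using q by simp
      then show "vec_index p i = vec_index q i" using i by (simp add: w_def)
    qed (use p q in simp)
    with False show False by simp
  qed
  then have k0: "k \<noteq> 0" using kW by auto
  define c where "c = 1 / k"
  \<comment> \<open>Exactly the condition for \<open>x - c \<langle>x, w\<rangle> w\<close> to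
    preserve norms, as the expansion of its squared norm shows.\<close>
  have cW: "c + cnj c = c * cnj c * W"
    using k0 unfolding c_def kW[symmetric] by (simp add: field_simps)
  obtain A where A: "A \<in> carrier_mat n n"
    and Ax: "\<And>x. x \<in> carrier_vec n \<Longrightarrow> A *\<^sub>v x = (x \<bullet>c w) \<cdot>\<^sub>v ((- c) \<cdot>\<^sub>v w) + 1 \<cdot>\<^sub>v x"
    using rank_one_plus_scalar_mat[of w n "(- c) \<cdot>\<^sub>v w" 1] w by auto
  obtain B where B: "B \<in> carrier_mat n n"
    and Bx: "\<And>x. x \<in> carrier_vec n \<Longrightarrow> B *\<^sub>v x = (x \<bullet>c w) \<cdot>\<^sub>v ((- cnj c) \<cdot>\<^sub>v w) + 1 \<cdot>\<^sub>v x"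
    using rank_one_plus_scalar_mat[of w n "(- cnj c) \<cdot>\<^sub>v w" 1] w by auto
  \<comment> \<open>The inverse is the same kind of map with conjugated coefficient. Keeping
    \<open>e\<close> general covers both orders of composition, with \<open>e = c\<close> and
    \<open>e = cnj c\<close>.\<close>
  have inverse: "(y \<bullet>c w) \<cdot>\<^sub>v ((- cnj e) \<cdot>\<^sub>v w) + 1 \<cdot>\<^sub>v y = x"
    if x: "x \<in> carrier_vec n" and y: "y = (x \<bullet>c w) \<cdot>\<^sub>v ((- e) \<cdot>\<^sub>v w) + 1 \<cdot>\<^sub>v x"
      and e: "e + cnj e = e * cnj e * W" for e x y
  proof (rule eq_vecI)
    fix i assume i: "i < dim_vec x"
    define \<xi> where "\<xi> = x \<bullet>c w"
    have yw: "y \<bullet>c w = \<xi> - \<xi> * e * W"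
      unfolding y using x w by (simp add: cip_linear W_def \<xi>_def)
    have "vec_index ((y \<bullet>c w) \<cdot>\<^sub>v ((- cnj e) \<cdot>\<^sub>v w) + 1 \<cdot>\<^sub>v y) i =
        vec_index x i - (e + cnj e) * \<xi> * vec_index w i + e * cnj e * W * \<xi> * vec_index w i"
      unfolding yw using i x w by (simp add: y \<xi>_def[symmetric] algebra_simps)
    then show "vec_index ((y \<bullet>c w) \<cdot>\<^sub>v ((- cnj e) \<cdot>\<^sub>v w) + 1 \<cdot>\<^sub>v y) i = vec_index x i"
      unfolding e by simp
  qed (use x y w in simp)
  have "cvec_norm (A *\<^sub>v x) = cvec_norm x" if x: "x \<in> carrier_vec n" for x
  proof (rule cvec_norm_eqI)
    define \<xi> where "\<xi> = x \<bullet>c w"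
    have wx: "w \<bullet>c x = cnj \<xi>" using x w by (simp add: \<xi>_def cnj_cip)
    have "(A *\<^sub>v x) \<bullet>c (A *\<^sub>v x) = x \<bullet>c x - (c + cnj c) * \<xi> * cnj \<xi> + c * cnj c * W * \<xi> * cnj \<xi>"
      unfolding Ax[OF x] using x w
      by (simp add: cip_linear wx flip: \<xi>_def W_def) (simp add: algebra_simps)
    then show "(A *\<^sub>v x) \<bullet>c (A *\<^sub>v x) = x \<bullet>c x"
      unfolding cW by simp
  qed
  moreover have "B *\<^sub>v (A *\<^sub>v x) = x \<and> A *\<^sub>v (B *\<^sub>v x) = x" if x: "x \<in> carrier_vec n" for x
  proof
    have car: "A *\<^sub>v x \<in> carrier_vec n" "B *\<^sub>v x \<in> carrier_vec n" using A B x by auto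
    show "B *\<^sub>v (A *\<^sub>v x) = x"
      unfolding Bx[OF car(1)] by (rule inverse[OF x Ax[OF x] cW])
    have "cnj c + cnj (cnj c) = cnj c * cnj (cnj c) * W"
      using cW by (simp add: algebra_simps)
    then show "A *\<^sub>v (B *\<^sub>v x) = x"
      unfolding Ax[OF car(2)] using inverse[OF x Bx[OF x]] by simp
  qed
  ultimately have U: "unitary_mat n A"
    unfolding unitary_mat_def using A B by blast
  show thesis
  proof (rule that[OF U])
    show "A *\<^sub>v p = q"
      unfolding Ax[OF p] k_def[symmetric] c_def using k0 p q
      by (intro eq_vecI) (auto simp: w_def)
    show "A *\<^sub>v x = x" if x: "x \<in> carrier_vec n" "x \<bullet>c p = x \<bullet>c q" for x
    proof -
      have "x \<bullet>c w = 0" unfolding w_def using x p q by (simp add: cip_linear)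
      then show ?thesis
        unfolding Ax[OF x(1)] using x w by (intro eq_vecI) auto
    qed
  qed
qed

text \<open>After \<open>A\<close> has moved \<open>p\<close> to \<open>p'\<close>, a second
  Householder map moves \<open>A q\<close> to \<open>q'\<close>. It leaves \<open>p'\<close> fixed
  because \<open>\<langle>p', A q\<rangle> = \<langle>p, q\<rangle> = \<langle>p',
  q'\<rangle>\<close>.\<close>

lemma unitary_mat_moving_pair:
  assumes car: "p \<in> carrier_vec n" "q \<in> carrier_vec n" "p' \<in> carrier_vec n" "q' \<in> carrier_vec n"
    and np: "cvec_norm p = cvec_norm p'" and nq: "cvec_norm q = cvec_norm q'"
    and pq: "p \<bullet>c q = p' \<bullet>c q'"
  obtains A where "unitary_mat n A" "A *\<^sub>v p = p'" "A *\<^sub>v q = q'"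
proof -
  obtain A where A: "unitary_mat n A" "A *\<^sub>v p = p'"
    using unitary_mat_moving[OF car(1,3) np] by blast
  have Ac: "A \<in> carrier_mat n n" using A by (simp add: unitary_mat_def)
  have Aq: "A *\<^sub>v q \<in> carrier_vec n" "cvec_norm (A *\<^sub>v q) = cvec_norm q'"
    using A car nq by (auto simp: unitary_mat_def)
  obtain B where B: "unitary_mat n B" "B *\<^sub>v (A *\<^sub>v q) = q'"
    and Bfix: "\<And>x. x \<in> carrier_vec n \<Longrightarrow> x \<bullet>c (A *\<^sub>v q) = x \<bullet>c q' \<Longrightarrow> B *\<^sub>v x = x"
    using unitary_mat_moving[OF Aq(1) car(4) Aq(2)] by blast
  have Bc: "B \<in> carrier_mat n n" using B by (simp add: unitary_mat_def)
  have "p' \<bullet>c (A *\<^sub>v q) = p' \<bullet>c q'"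
    using unitary_mat_cip[OF A(1) car(1,2)] A(2) pq by simp
  then have "B *\<^sub>v p' = p'" by (rule Bfix[OF car(3)])
  moreover have "(B * A) *\<^sub>v x = B *\<^sub>v (A *\<^sub>v x)" if "x \<in> carrier_vec n" for x
    using Ac Bc that by (intro assoc_mult_mat_vec)
  ultimately show thesis
    using that[OF unitary_mat_mult[OF A(1) B(1)]] A(2) B(2) car by simp
qed

subsection \<open>Congruence of triangles\<close>

lemma embed_vec_carrier:
  assumes "z \<in> carrier_vec n" "n \<le> r"
  shows "embed_vec r z \<in> carrier_vec r"
  using assms by (intro carrier_vecI) (simp add: embed_vec_def)

lemma embed_vec_index:
  assumes "z \<in> carrier_vec n" "n \<le> r" "i < r"
  shows "vec_index (embed_vec r z) i = (if i < n then vec_index z i else 0)"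
  using assms by (auto simp: embed_vec_def)

lemma embed_vec_cip:
  assumes "z \<in> carrier_vec n" "w \<in> carrier_vec n" "n \<le> r"
  shows "embed_vec r z \<bullet>c embed_vec r w = z \<bullet>c w"
proof -
  have "embed_vec r z \<bullet>c embed_vec r w =
      (\<Sum>i<r. (if i < n then vec_index z i else 0) * cnj (if i < n then vec_index w i else 0))"
    using assms embed_vec_carrier[of z n r] embed_vec_carrier[of w n r]
    by (simp add: cip_sum embed_vec_index)
  also have "\<dots> = (\<Sum>i<n. vec_index z i * cnj (vec_index w i))"
    using assms by (intro sum.mono_neutral_cong_right) auto
  finally show ?thesis using assms by (simp add: cip_sum)
qed

lemma embed_vec_norm:
  assumes "z \<in> carrier_vec n" "n \<le> r"
  shows "cvec_norm (embed_vec r z) = cvec_norm z"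
  by (simp add: cvec_norm_def embed_vec_cip[OF assms(1,1,2)])

lemma embed_vec_ball:
  assumes "z \<in> unit_ball n" "n \<le> r"
  shows "embed_vec r z \<in> unit_ball r"
  using assms by (auto simp: unit_ball_iff embed_vec_carrier embed_vec_norm)

lemma embed_vec_inj:
  assumes z: "z \<in> carrier_vec n" and w: "w \<in> carrier_vec n" and n: "n \<le> r"
    and eq: "embed_vec r z = embed_vec r w"
  shows "z = w"
proof (rule eq_vecI)
  fix i assume "i < dim_vec w"
  then show "vec_index z i = vec_index w i"
    using eq embed_vec_index[OF z n, of i] embed_vec_index[OF w n, of i] w n by simp
qed (use z w in simp)

text \<open>The involution is built coordinatewise from \<open>a\<close> and \<open>z\<close> with
  coefficients that depend only on Hermitian products, and padding with zeros preserves
  these.\<close>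

lemma embed_vec_ball_invol:
  assumes a: "a \<in> carrier_vec n" and z: "z \<in> carrier_vec n" and n: "n \<le> r"
  shows "ball_invol (embed_vec r a) (embed_vec r z) = embed_vec r (ball_invol a z)"
proof (rule eq_vecI)
  have inv: "ball_invol a z \<in> carrier_vec n"
    using a z by (intro carrier_vecI) (simp add: ball_invol_def proj_span_def)
  note car = embed_vec_carrier[OF a n] embed_vec_carrier[OF z n] embed_vec_carrier[OF inv n]
  show "dim_vec (ball_invol (embed_vec r a) (embed_vec r z)) = dim_vec (embed_vec r (ball_invol a z))"
    using car by (simp add: ball_invol_def proj_span_def)
  fix i assume "i < dim_vec (embed_vec r (ball_invol a z))"
  then have i: "i < r" using car by simp
  have lhs: "vec_index (ball_invol (embed_vec r a) (embed_vec r z)) i =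
    1 / (1 - z \<bullet>c a) * (vec_index (embed_vec r a) i
      - (z \<bullet>c a) / (a \<bullet>c a) * vec_index (embed_vec r a) i
      - complex_of_real (sqrt (1 - (cvec_norm a)\<^sup>2)) * (vec_index (embed_vec r z) i
          - (z \<bullet>c a) / (a \<bullet>c a) * vec_index (embed_vec r a) i))"
    using car i a z n
    by (simp add: ball_invol_def proj_span_def embed_vec_cip[of _ n] embed_vec_norm[of _ n])
  have rhs: "vec_index (ball_invol a z) i =
    1 / (1 - z \<bullet>c a) * (vec_index a i - (z \<bullet>c a) / (a \<bullet>c a) * vec_index a i
      - complex_of_real (sqrt (1 - (cvec_norm a)\<^sup>2)) * (vec_index z i
          - (z \<bullet>c a) / (a \<bullet>c a) * vec_index a i))" if "i < n"
    using that a z by (simp add: ball_invol_def proj_span_def)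
  show "vec_index (ball_invol (embed_vec r a) (embed_vec r z)) i = vec_index (embed_vec r (ball_invol a z)) i"
    unfolding lhs embed_vec_index[OF a n i] embed_vec_index[OF z n i] embed_vec_index[OF inv n i]
    using rhs by auto
qed

lemma embed_vec_pseudohyp_dist:
  assumes "a \<in> unit_ball n" "z \<in> unit_ball n" "n \<le> r"
  shows "pseudohyp_dist (embed_vec r a) (embed_vec r z) = pseudohyp_dist a z"
  using assms embed_vec_norm[OF ball_invol_carrier[of a n z], of r]
  by (simp add: pseudohyp_dist_def embed_vec_ball_invol[of _ n] unit_ball_carrier)

lemma embed_vec_kos:
  assumes "x \<in> unit_ball n" "y \<in> unit_ball n" "z \<in> unit_ball n" "n \<le> r"
  shows "kos (embed_vec r x) (embed_vec r y) (embed_vec r z) = kos x y z"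
proof -
  have "ball_invol (embed_vec r x) (embed_vec r y) \<bullet>c ball_invol (embed_vec r x) (embed_vec r z)
      = ball_invol x y \<bullet>c ball_invol x z"
    using assms by (simp add: embed_vec_ball_invol[of _ n] unit_ball_carrier
        embed_vec_cip[of _ n] ball_invol_carrier)
  then show ?thesis
    using assms by (simp add: kos_eq[of _ n] kos_eq[of _ r] embed_vec_ball embed_vec_pseudohyp_dist[of _ n])
qed

section \<open>Elementary properties of the distance and of kos\<close>

lemma ball_invol_dim:
  assumes "x \<in> unit_ball n" "y \<in> unit_ball n"
  shows "dim_vec (ball_invol x y) = n"
  using ball_invol_carrier[OF assms(1) unit_ball_carrier[OF assms(2)]] by simp

lemma pseudohyp_dist_pos:
  assumes x: "x \<in> unit_ball n" and y: "y \<in> unit_ball n" and "x \<noteq> y"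
  shows "0 < pseudohyp_dist x y"
proof -
  have "ball_invol x y \<noteq> 0\<^sub>v n"
    using ball_invol_involution[OF x y] ball_invol_involution[OF x x] ball_invol_self[OF x] \<open>x \<noteq> y\<close>
    by metis
  then have "cvec_norm (ball_invol x y) \<noteq> 0"
    by (simp add: cvec_norm_eq_0_iff ball_invol_dim[OF x y])
  then show ?thesis
    using cvec_norm_nonneg[of "ball_invol x y"] by (simp add: pseudohyp_dist_def less_le)
qed

lemma pseudohyp_dist_less_1:
  "x \<in> unit_ball n \<Longrightarrow> y \<in> unit_ball n \<Longrightarrow> pseudohyp_dist x y < 1"
  using ball_invol_mem[of x n y] by (simp add: pseudohyp_dist_def unit_ball_def)

lemma cip_ball_invol_kos:
  assumes x: "x \<in> unit_ball n" and y: "y \<in> unit_ball n" and z: "z \<in> unit_ball n"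
  shows "ball_invol x y \<bullet>c ball_invol x z =
    of_real (pseudohyp_dist x y) * of_real (pseudohyp_dist x z) * kos x y z"
proof (cases "pseudohyp_dist x y = 0 \<or> pseudohyp_dist x z = 0")
  case True
  have "cmod (ball_invol x y \<bullet>c ball_invol x z) \<le> pseudohyp_dist x y * pseudohyp_dist x z"
    unfolding pseudohyp_dist_def
    by (rule cvec_Cauchy_Schwarz) (simp add: ball_invol_dim[OF x] y z)
  with True show ?thesis by auto
next
  case False
  then show ?thesis by (simp add: kos_eq[OF x y z])
qed

lemma kos_cnj:
  assumes "x \<in> unit_ball n" "y \<in> unit_ball n" "z \<in> unit_ball n"
  shows "cnj (kos x y z) = kos x z y"
proof -
  have "dim_vec (ball_invol x y) = n" "dim_vec (ball_invol x z) = n"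
    using assms by (simp_all add: ball_invol_dim)
  then show ?thesis
    unfolding kos_def by (intro cnj_cip) simp
qed

lemma kos_self:
  assumes "x \<in> unit_ball n" "y \<in> unit_ball n" "x \<noteq> y"
  shows "kos x y y = 1"
  using pseudohyp_dist_pos[OF assms] unfolding kos_eq[OF assms(1,2,2)] cip_self
  by (simp add: pseudohyp_dist_def power2_eq_square)

lemma kos_norm_le_1:
  assumes "x \<in> unit_ball n" "y \<in> unit_ball n" "z \<in> unit_ball n"
  shows "cmod (kos x y z) \<le> 1"
proof -
  let ?u = "\<lambda>y. complex_of_real (1 / cvec_norm (ball_invol x y)) \<cdot>\<^sub>v ball_invol x y"
  have le: "cvec_norm (?u y) \<le> 1" for y
    by (simp add: norm_divide)
  have "cmod (kos x y z) \<le> cvec_norm (?u y) * cvec_norm (?u z)"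
    unfolding kos_def
    by (rule cvec_Cauchy_Schwarz) (simp add: assms ball_invol_dim[OF assms(1)])
  also have "\<dots> \<le> 1 * 1"
    by (intro mult_mono le) auto
  finally show ?thesis by simp
qed

section \<open>Congruence in terms of distances and kos\<close>

lemma congruent_kos:
  assumes c: "congruent n [p, q, r] m [x, y, z]"
    and pqr: "p \<in> unit_ball n" "q \<in> unit_ball n" "r \<in> unit_ball n"
    and xyz: "x \<in> unit_ball m" "y \<in> unit_ball m" "z \<in> unit_ball m"
  shows "kos p q r = kos x y z"
proof -
  define N where "N = max n m"
  have N: "n \<le> N" "m \<le> N" by (auto simp: N_def)
  obtain g where g: "g \<in> Aut_ball N" "g (embed_vec N p) = embed_vec N x"
    "g (embed_vec N q) = embed_vec N y" "g (embed_vec N r) = embed_vec N z"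
    using c unfolding congruent_def N_def[symmetric] by auto
  have "kos p q r = kos (embed_vec N p) (embed_vec N q) (embed_vec N r)"
    using embed_vec_kos[OF pqr N(1)] by simp
  also have "\<dots> = kos (embed_vec N x) (embed_vec N y) (embed_vec N z)"
    using kos_Aut[OF g(1), of "embed_vec N p" "embed_vec N q" "embed_vec N r"]
      pqr embed_vec_ball[OF _ N(1)] g by simp
  also have "\<dots> = kos x y z"
    using embed_vec_kos[OF xyz N(2)] by simp
  finally show ?thesis .
qed

text \<open>Distances and \<open>kos\<close> together determine the Gram matrix seen from the first
  vertex. The automorphism moves \<open>p\<close> to 0, applies the unitary map matching the two
  remaining vectors, and moves 0 to \<open>x\<close>, all in the larger ball.\<close>

lemma congruentI:
  assumes pqr: "p \<in> unit_ball n" "q \<in> unit_ball n" "r \<in> unit_ball n"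
    and xyz: "x \<in> unit_ball m" "y \<in> unit_ball m" "z \<in> unit_ball m"
    and d: "pseudohyp_dist p q = pseudohyp_dist x y" "pseudohyp_dist p r = pseudohyp_dist x z"
    and k: "kos p q r = kos x y z"
  shows "congruent n [p, q, r] m [x, y, z]"
proof -
  define N where "N = max n m"
  have N: "n \<le> N" "m \<le> N" by (auto simp: N_def)
  let ?e = "embed_vec N"
  have pqrN: "?e p \<in> unit_ball N" "?e q \<in> unit_ball N" "?e r \<in> unit_ball N"
    and xyzN: "?e x \<in> unit_ball N" "?e y \<in> unit_ball N" "?e z \<in> unit_ball N"
    using pqr xyz N embed_vec_ball by blast+
  have dist: "pseudohyp_dist (?e p) (?e q) = pseudohyp_dist (?e x) (?e y)"
     "pseudohyp_dist (?e p) (?e r) = pseudohyp_dist (?e x) (?e z)"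
    using d pqr xyz N by (simp_all add: embed_vec_pseudohyp_dist[of _ n] embed_vec_pseudohyp_dist[of _ m])
  have "kos (?e p) (?e q) (?e r) = kos (?e x) (?e y) (?e z)"
    using k embed_vec_kos[OF pqr N(1)] embed_vec_kos[OF xyz N(2)] by simp
  then have "ball_invol (?e p) (?e q) \<bullet>c ball_invol (?e p) (?e r)
      = ball_invol (?e x) (?e y) \<bullet>c ball_invol (?e x) (?e z)"
    using dist by (simp only: cip_ball_invol_kos[OF pqrN] cip_ball_invol_kos[OF xyzN])
  then obtain A where A: "unitary_mat N A"
    "A *\<^sub>v ball_invol (?e p) (?e q) = ball_invol (?e x) (?e y)"
    "A *\<^sub>v ball_invol (?e p) (?e r) = ball_invol (?e x) (?e z)"
    using unitary_mat_moving_pair[of "ball_invol (?e p) (?e q)" N "ball_invol (?e p) (?e r)"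
        "ball_invol (?e x) (?e y)" "ball_invol (?e x) (?e z)"] dist pqrN xyzN
    by (auto simp: pseudohyp_dist_def intro!: ball_invol_carrier dest: unit_ball_carrier)
  have Ac: "A \<in> carrier_mat N N" using A by (simp add: unitary_mat_def)
  define g where "g = ball_invol (?e x) \<circ> ((\<lambda>z. A *\<^sub>v z) \<circ> ball_invol (?e p))"
  have "g \<in> Aut_ball N"
    unfolding g_def by (intro Aut_ball_compose unitary_mat_Aut[OF A(1)] ball_invol_Aut pqrN xyzN)
  moreover have "g (?e p) = ?e x"
  proof -
    have "A *\<^sub>v 0\<^sub>v N = 0\<^sub>v N" using Ac by (intro eq_vecI) auto
    moreover have "ball_invol (?e x) (0\<^sub>v N) = ?e x"
      using ball_invol_involution[OF xyzN(1,1)] by (simp add: ball_invol_self[OF xyzN(1)])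
    ultimately show ?thesis by (simp add: g_def ball_invol_self[OF pqrN(1)])
  qed
  moreover have "g (?e q) = ?e y" "g (?e r) = ?e z"
    using xyzN by (simp_all add: g_def A(2,3) ball_invol_involution[of _ N])
  ultimately show ?thesis
    unfolding congruent_def N_def[symmetric] by (intro bexI[of _ g]) auto
qed

lemma congruent_distinct:
  assumes c: "congruent n ps m qs" and ps: "set ps \<subseteq> unit_ball n" "distinct ps"
  shows "distinct qs"
proof -
  define N where "N = max n m"
  have N: "n \<le> N" by (auto simp: N_def)
  obtain g where g: "g \<in> Aut_ball N"
    "map (\<lambda>p. g (embed_vec N p)) ps = map (embed_vec N) qs"
    using c unfolding congruent_def N_def[symmetric] by auto
  have "inj_on g (unit_ball N)"
    using g(1) by (simp add: Aut_ball_def bij_betw_def)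
  moreover have "inj_on (embed_vec N) (unit_ball n)"
    using embed_vec_inj[OF _ _ N] by (auto simp: inj_on_def unit_ball_iff)
  ultimately have "inj_on (\<lambda>p. g (embed_vec N p)) (set ps)"
    using ps(1) embed_vec_ball[OF _ N] by (simp add: inj_on_def subset_iff)
  then have "distinct (map (embed_vec N) qs)"
    using ps(2) unfolding g(2)[symmetric] by (simp add: distinct_map)
  then show ?thesis by (simp add: distinct_map)
qed

text \<open>At 0 the involution is \<open>z \<mapsto> - z\<close>; the sign disappears in norms and
  in Hermitian products, so side lengths and \<open>kos\<close> can be prescribed directly.\<close>

lemma zero_vertex:
  assumes u: "u \<in> carrier_vec n" "cvec_norm u = 1" and v: "v \<in> carrier_vec n" "cvec_norm v = 1"
    and d: "0 < d" "d < 1" "0 < e" "e < 1"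
  shows "pseudohyp_dist (0\<^sub>v n) (complex_of_real d \<cdot>\<^sub>v u) = d"
    and "kos (0\<^sub>v n) (complex_of_real d \<cdot>\<^sub>v u) (complex_of_real e \<cdot>\<^sub>v v) = u \<bullet>c v"
proof -
  have mem: "0\<^sub>v n \<in> unit_ball n" "complex_of_real d \<cdot>\<^sub>v u \<in> unit_ball n" "complex_of_real e \<cdot>\<^sub>v v \<in> unit_ball n"
    using u v d by (auto simp: unit_ball_iff)
  have dist: "pseudohyp_dist (0\<^sub>v n) (complex_of_real d \<cdot>\<^sub>v u) = d"
    if "u \<in> carrier_vec n" "cvec_norm u = 1" "0 < d" for u d
    using that by (simp add: pseudohyp_dist_def ball_invol_zero_left)
  then show "pseudohyp_dist (0\<^sub>v n) (complex_of_real d \<cdot>\<^sub>v u) = d"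
    using u d by blast
  show "kos (0\<^sub>v n) (complex_of_real d \<cdot>\<^sub>v u) (complex_of_real e \<cdot>\<^sub>v v) = u \<bullet>c v"
    unfolding kos_eq[OF mem] dist[OF u d(1)] dist[OF v d(3)]
    using u v d by (simp add: ball_invol_zero_left cip_linear)
qed

subsection \<open>Gram matrices of three unit vectors\<close>

lemma det_2:
  fixes A :: "'a :: comm_ring_1 mat"
  assumes A: "A \<in> carrier_mat 2 2"
  shows "Determinant.det A = A $$ (0,0) * A $$ (1,1) - A $$ (0,1) * A $$ (1,0)"
proof -
  have "Determinant.det (mat_delete A 0 j) = mat_delete A 0 j $$ (0, 0)" for j
    using mat_delete_carrier[OF A] by (intro det_single) simp
  then show ?thesis
    using laplace_expansion_row[OF A, of 0] A
    by (simp add: numeral_2_eq_2 cofactor_def mat_delete_def)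
qed

lemma det_3:
  fixes A :: "'a :: comm_ring_1 mat"
  assumes A: "A \<in> carrier_mat 3 3"
  shows "Determinant.det A =
    A $$ (0,0) * (A $$ (1,1) * A $$ (2,2) - A $$ (1,2) * A $$ (2,1))
    - A $$ (0,1) * (A $$ (1,0) * A $$ (2,2) - A $$ (1,2) * A $$ (2,0))
    + A $$ (0,2) * (A $$ (1,0) * A $$ (2,1) - A $$ (1,1) * A $$ (2,0))"
proof -
  have minor: "Determinant.det (mat_delete A 0 j) =
      mat_delete A 0 j $$ (0,0) * mat_delete A 0 j $$ (1,1)
      - mat_delete A 0 j $$ (0,1) * mat_delete A 0 j $$ (1,0)" for j
    using mat_delete_carrier[OF A] by (intro det_2) simp
  have minors:
    "Determinant.det (mat_delete A 0 0) = A $$ (1,1) * A $$ (2,2) - A $$ (1,2) * A $$ (2,1)"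
    "Determinant.det (mat_delete A 0 1) = A $$ (1,0) * A $$ (2,2) - A $$ (1,2) * A $$ (2,0)"
    "Determinant.det (mat_delete A 0 2) = A $$ (1,0) * A $$ (2,1) - A $$ (1,1) * A $$ (2,0)"
    unfolding minor using A by (simp_all add: mat_delete_def numeral_2_eq_2)
  have lt3: "{..<3::nat} = {0, 1, 2}" by auto
  have "Determinant.det A = A $$ (0,0) * cofactor A 0 0 + (A $$ (0,1) * cofactor A 0 1 + A $$ (0,2) * cofactor A 0 2)"
    using laplace_expansion_row[OF A, of 0] by (simp add: lt3)
  then show ?thesis
    unfolding cofactor_def minors by (simp add: right_diff_distrib)
qed

lemma less_3_cases: "i < (3::nat) \<Longrightarrow> i = 0 \<or> i = 1 \<or> i = 2"
  by linarith

lemma kos_mat_carrier [simp]: "kos_mat a b c \<in> carrier_mat 3 3"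
  by (rule carrier_matI) (simp_all add: kos_mat_def mat_of_rows_list_def)

lemma kos_mat_dim [simp]: "dim_row (kos_mat a b c) = 3" "dim_col (kos_mat a b c) = 3"
  by (simp_all add: kos_mat_def mat_of_rows_list_def)

lemma kos_mat_index [simp]:
  "kos_mat a b c $$ (0, 0) = 1" "kos_mat a b c $$ (0, Suc 0) = a" "kos_mat a b c $$ (0, 2) = b"
  "kos_mat a b c $$ (Suc 0, 0) = cnj a" "kos_mat a b c $$ (Suc 0, Suc 0) = 1" "kos_mat a b c $$ (Suc 0, 2) = c"
  "kos_mat a b c $$ (2, 0) = cnj b" "kos_mat a b c $$ (2, Suc 0) = cnj c" "kos_mat a b c $$ (2, 2) = 1"
  by (simp_all add: kos_mat_def mat_of_rows_list_def)

lemma kos_mat_adjoint: "mat_adjoint (kos_mat a b c) = kos_mat a b c"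
proof (rule eq_matI)
  show dims: "dim_row (mat_adjoint (kos_mat a b c)) = dim_row (kos_mat a b c)"
    "dim_col (mat_adjoint (kos_mat a b c)) = dim_col (kos_mat a b c)"
    by (simp_all add: mat_adjoint_def)
  fix i j assume "i < dim_row (kos_mat a b c)" "j < dim_col (kos_mat a b c)"
  then have ij: "i < 3" "j < 3" by simp_all
  then have "mat_adjoint (kos_mat a b c) $$ (i, j) = cnj (kos_mat a b c $$ (j, i))"
    by (simp add: mat_adjoint_def mat_of_rows_index)
  then show "mat_adjoint (kos_mat a b c) $$ (i, j) = kos_mat a b c $$ (i, j)"
    using less_3_cases[OF ij(1)] less_3_cases[OF ij(2)] by auto
qed

lemma kos_mat_quadratic_form:
  assumes v: "v \<in> carrier_vec 3"
  defines "x \<equiv> vec_index v 0" and "y \<equiv> vec_index v 1" and "z \<equiv> vec_index v 2"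
  shows "(kos_mat a b c *\<^sub>v v) \<bullet>c v =
    (x + a * y + b * z) * cnj x + (cnj a * x + y + c * z) * cnj y + (cnj b * x + cnj c * y + z) * cnj z"
proof -
  have lt3: "{..<3::nat} = {0, 1, 2}" by auto
  have idx: "vec_index (kos_mat a b c *\<^sub>v v) i =
      kos_mat a b c $$ (i, 0) * x + kos_mat a b c $$ (i, 1) * y + kos_mat a b c $$ (i, 2) * z" if "i < 3" for i
    using that v by (simp add: scalar_prod_def atLeast0LessThan lt3 x_def y_def z_def)
  show ?thesis
    using v by (simp add: cip_sum lt3 idx del: index_mult_mat_vec) (simp add: x_def y_def z_def)
qed

lemma kos_mat_psd_gram:
  assumes u: "u \<in> carrier_vec n" "u \<bullet>c u = 1" and v: "v \<in> carrier_vec n" "v \<bullet>c v = 1"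
    and w: "w \<in> carrier_vec n" "w \<bullet>c w = 1"
  shows "psd_mat 3 (kos_mat (u \<bullet>c v) (u \<bullet>c w) (v \<bullet>c w))"
  unfolding psd_mat_def
proof (intro conjI ballI kos_mat_carrier kos_mat_adjoint)
  fix h :: "complex vec" assume h: "h \<in> carrier_vec 3"
  define x y z where "x = vec_index h 0" and "y = vec_index h 1" and "z = vec_index h 2"
  \<comment> \<open>The coefficients are conjugated because the matrix multiplies \<open>h\<close>
    while the product is linear in its first argument; with them the quadratic form is
    \<open>|s|\<^sup>2\<close>.\<close>
  define s where "s = cnj x \<cdot>\<^sub>v u + (cnj y \<cdot>\<^sub>v v + cnj z \<cdot>\<^sub>v w)"
  have "cnj (u \<bullet>c v) = v \<bullet>c u" "cnj (u \<bullet>c w) = w \<bullet>c u" "cnj (v \<bullet>c w) = w \<bullet>c v"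
    using u v w by (simp_all add: cnj_cip)
  then have "(kos_mat (u \<bullet>c v) (u \<bullet>c w) (v \<bullet>c w) *\<^sub>v h) \<bullet>c h = s \<bullet>c s"
    unfolding kos_mat_quadratic_form[OF h] s_def x_def[symmetric] y_def[symmetric] z_def[symmetric]
    using u v w by (simp add: cip_linear) (simp add: algebra_simps)
  then show "0 \<le> (kos_mat (u \<bullet>c v) (u \<bullet>c w) (v \<bullet>c w) *\<^sub>v h) \<bullet>c h"
    unfolding cip_self by (simp add: less_eq_complex_def del: of_real_power)
qed

text \<open>Cholesky factorization: \<open>u = (1, 0, 0)\<close>, \<open>v = (cnj a, s, 0)\<close>,
  \<open>w = (cnj b, cnj y, t)\<close>, conjugated since the product is antilinear in its second
  argument. The entry \<open>c\<close> forces \<open>s y = c - cnj a b\<close>, and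
  \<open>le\<close> says that enough length is left for \<open>t\<close>.\<close>

lemma gram_vectors_exist:
  assumes a: "cmod a \<le> 1" and b: "cmod b \<le> 1"
    and le: "(cmod (c - cnj a * b))\<^sup>2 \<le> (1 - (cmod a)\<^sup>2) * (1 - (cmod b)\<^sup>2)"
  obtains u v w where "u \<in> carrier_vec 3" "v \<in> carrier_vec 3" "w \<in> carrier_vec 3"
    "u \<bullet>c u = 1" "v \<bullet>c v = 1" "w \<bullet>c w = 1" "u \<bullet>c v = a" "u \<bullet>c w = b" "v \<bullet>c w = c"
proof -
  define s where "s = sqrt (1 - (cmod a)\<^sup>2)"
  have s2: "s\<^sup>2 = 1 - (cmod a)\<^sup>2"
    using a by (simp add: s_def power_le_one)
  \<comment> \<open>For \<open>s = 0\<close> the quotient is \<open>0\<close>, the correct value, since then \<open>c = cnj a * b\<close> by \<open>le\<close>.\<close>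
  define y where "y = (c - cnj a * b) / complex_of_real s"
  have sy: "complex_of_real s * y = c - cnj a * b"
  proof (cases "s = 0")
    case True
    then have "(cmod (c - cnj a * b))\<^sup>2 \<le> 0" using le s2 by simp
    then show ?thesis using True by (simp add: y_def)
  qed (simp add: y_def)
  have y2: "(cmod y)\<^sup>2 \<le> 1 - (cmod b)\<^sup>2"
  proof (cases "s = 0")
    case True
    then show ?thesis using b by (simp add: y_def power_le_one)
  next
    case False
    have "s\<^sup>2 * (cmod y)\<^sup>2 = (cmod (c - cnj a * b))\<^sup>2"
      unfolding sy[symmetric] by (simp add: norm_mult power_mult_distrib)
    then have "s\<^sup>2 * (cmod y)\<^sup>2 \<le> s\<^sup>2 * (1 - (cmod b)\<^sup>2)"
      using le s2 by simp
    then show ?thesis using False by simp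
  qed
  define t where "t = sqrt (1 - (cmod b)\<^sup>2 - (cmod y)\<^sup>2)"
  have t2: "t\<^sup>2 = 1 - (cmod b)\<^sup>2 - (cmod y)\<^sup>2"
    using y2 by (simp add: t_def)
  define u where "u = Matrix.vec 3 (\<lambda>i. if i = 0 then 1 else 0 :: complex)"
  define v where "v = Matrix.vec 3 (\<lambda>i. if i = 0 then cnj a else if i = 1 then of_real s else 0)"
  define w where "w = Matrix.vec 3 (\<lambda>i. if i = 0 then cnj b else if i = 1 then cnj y else of_real t)"
  have lt3: "{..<3::nat} = {0, 1, 2}" by auto
  have "v \<bullet>c v = of_real ((cmod a)\<^sup>2 + s\<^sup>2)" "w \<bullet>c w = of_real ((cmod b)\<^sup>2 + (cmod y)\<^sup>2 + t\<^sup>2)"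
    by (simp_all add: v_def w_def cip_self_sum lt3 power2_eq_square)
  then have "v \<bullet>c v = 1" "w \<bullet>c w = 1"
    using s2 t2 by simp_all
  moreover have "u \<bullet>c u = 1" "u \<bullet>c v = a" "u \<bullet>c w = b" "v \<bullet>c w = c"
    using sy by (simp_all add: u_def v_def w_def cip_sum lt3)
  moreover have "u \<in> carrier_vec 3" "v \<in> carrier_vec 3" "w \<in> carrier_vec 3"
    by (simp_all add: u_def v_def w_def)
  ultimately show thesis using that by blast
qed

lemma kos_mat_psd_imp_bound:
  assumes psd: "psd_mat 3 (kos_mat a b c)" and a: "cmod a \<le> 1" and b: "cmod b \<le> 1"
  shows "(cmod (c - cnj a * b))\<^sup>2 \<le> (1 - (cmod a)\<^sup>2) * (1 - (cmod b)\<^sup>2)"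
proof -
  define w where "w = c - cnj a * b"
  define p q where "p = 1 - (cmod a)\<^sup>2" and "q = 1 - (cmod b)\<^sup>2"
  have pq: "p \<ge> 0" "q \<ge> 0" using a b by (simp_all add: p_def q_def power_le_one)
  define N where "N = (cmod w)\<^sup>2"
  have N: "N \<ge> 0" by (simp add: N_def)
  have cs: "complex_of_real p = 1 - a * cnj a" "complex_of_real q = 1 - b * cnj b"
    "complex_of_real N = w * cnj w"
    unfolding p_def q_def N_def of_real_diff by (simp_all only: complex_norm_square) simp_all
  \<comment> \<open>The first coordinate of the test vector completes the square; the form is then that of the
    Schur complement with diagonal \<open>p\<close>, \<open>q\<close> and off-diagonal entry \<open>w\<close>.\<close>
  have form: "0 \<le> p * s\<^sup>2 + q * N * t\<^sup>2 - 2 * s * t * N" for s t :: real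
  proof -
    \<comment> \<open>The factor \<open>cnj w\<close> in \<open>z\<close> aligns phases: both cross
      terms become \<open>- s t |w|\<^sup>2\<close>, and a real form in \<open>s\<close> and
      \<open>t\<close> remains.\<close>
    define y z where "y = complex_of_real s" and "z = - (of_real t * cnj w)"
    define x where "x = - (a * y + b * z)"
    define h where "h = Matrix.vec 3 (\<lambda>i. if i = 0 then x else if i = 1 then y else z)"
    have h: "h \<in> carrier_vec 3" "vec_index h 0 = x" "vec_index h 1 = y" "vec_index h 2 = z"
      by (simp_all add: h_def)
    have "(kos_mat a b c *\<^sub>v h) \<bullet>c h =
        (x + a * y + b * z) * cnj x + (cnj a * x + y + c * z) * cnj y + (cnj b * x + cnj c * y + z) * cnj z"
      using kos_mat_quadratic_form[OF h(1)] unfolding h(2-4) .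
    also have "\<dots> = (1 - a * cnj a) * y * cnj y + (1 - b * cnj b) * z * cnj z + w * z * cnj y + cnj w * y * cnj z"
      unfolding x_def w_def by (simp add: algebra_simps)
    also have "\<dots> = of_real (p * s\<^sup>2 + q * N * t\<^sup>2 - 2 * s * t * N)"
      unfolding of_real_add of_real_diff of_real_mult cs y_def z_def
      by (simp add: algebra_simps power2_eq_square)
    finally have "(kos_mat a b c *\<^sub>v h) \<bullet>c h = of_real (p * s\<^sup>2 + q * N * t\<^sup>2 - 2 * s * t * N)" .
    moreover have "0 \<le> (kos_mat a b c *\<^sub>v h) \<bullet>c h"
      using psd h(1) unfolding psd_mat_def by blast
    ultimately show ?thesis
      by (simp only: less_eq_complex_def Re_complex_of_real zero_complex.simps)
  qed
  have "N \<le> p * q"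
  proof (cases "p = 0")
    case True
    \<comment> \<open>For \<open>p = 0\<close>, \<open>t = 1\<close> the form is
      \<open>(q - 2 s) N\<close>; this \<open>s\<close> makes the bracket -1.\<close>
    have "0 \<le> - N"
      using form[of "(q + 1) / 2" 1] True by (simp add: algebra_simps)
    then show ?thesis using True by simp
  next
    case False
    \<comment> \<open>For \<open>t = p\<close> the form is minimal in \<open>s\<close> at
      \<open>s = N\<close>.\<close>
    have "0 \<le> p * (N * (p * q - N))"
      using form[of N p] by (simp add: algebra_simps power2_eq_square)
    then have *: "0 \<le> N * (p * q - N)"
      using False pq by (simp add: zero_le_mult_iff)
    show ?thesis
    proof (cases "N = 0")
      case True
      then show ?thesis using pq by simp
    next
      case False
      then show ?thesis using * N by (simp add: zero_le_mult_iff)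
    qed
  qed
  then show ?thesis by (simp add: N_def w_def p_def q_def)
qed

text \<open>The bound yields vectors realizing the matrix, and Gram matrices are positive
  semidefinite; conversely, the form is evaluated at test vectors.\<close>

lemma kos_mat_psd_iff:
  assumes a: "cmod a \<le> 1" and b: "cmod b \<le> 1"
  shows "psd_mat 3 (kos_mat a b c) \<longleftrightarrow>
    (cmod (c - cnj a * b))\<^sup>2 \<le> (1 - (cmod a)\<^sup>2) * (1 - (cmod b)\<^sup>2)"
proof
  assume "(cmod (c - cnj a * b))\<^sup>2 \<le> (1 - (cmod a)\<^sup>2) * (1 - (cmod b)\<^sup>2)"
  from gram_vectors_exist[OF a b this] show "psd_mat 3 (kos_mat a b c)"
    using kos_mat_psd_gram by metis
qed (rule kos_mat_psd_imp_bound[OF _ a b])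

text \<open>The left side is the determinant of the Schur complement of the first diagonal entry.
  That entry is 1, so it equals the full determinant on the right.\<close>

lemma kos_mat_schur_complement:
  "(1 - (cmod a)\<^sup>2) * (1 - (cmod b)\<^sup>2) - (cmod (c - cnj a * b))\<^sup>2 =
    1 + 2 * Re (a * cnj b * c) - (cmod a)\<^sup>2 - (cmod b)\<^sup>2 - (cmod c)\<^sup>2"
  unfolding cmod_power2 by (simp add: algebra_simps power2_eq_square)

lemma kos_mat_det:
  "Determinant.det (kos_mat a b c) =
    of_real (1 + 2 * Re (a * cnj b * c) - (cmod a)\<^sup>2 - (cmod b)\<^sup>2 - (cmod c)\<^sup>2)"
proof -
  have "Determinant.det (kos_mat a b c) =
      1 + (a * cnj b * c + cnj (a * cnj b * c)) - a * cnj a - b * cnj b - c * cnj c"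
    by (simp add: det_3[OF kos_mat_carrier] algebra_simps)
  then show ?thesis
    unfolding complex_add_cnj by (simp add: complex_norm_square del: of_real_power)
qed

lemma kos_mat_tetra_eq:
  assumes x: "x1 \<in> unit_ball m" "x2 \<in> unit_ball m" "x3 \<in> unit_ball m" "x4 \<in> unit_ball m"
    and d: "x1 \<noteq> x2" "x1 \<noteq> x3" "x1 \<noteq> x4"
  shows "kos_mat_tetra [x1, x2, x3, x4] = kos_mat (kos x1 x2 x3) (kos x1 x2 x4) (kos x1 x3 x4)"
proof (rule eq_matI)
  fix i j
  assume "i < dim_row (kos_mat (kos x1 x2 x3) (kos x1 x2 x4) (kos x1 x3 x4))"
    and "j < dim_col (kos_mat (kos x1 x2 x3) (kos x1 x2 x4) (kos x1 x3 x4))"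
  then have ij: "i < 3" "j < 3" by simp_all
  show "kos_mat_tetra [x1, x2, x3, x4] $$ (i, j) =
      kos_mat (kos x1 x2 x3) (kos x1 x2 x4) (kos x1 x3 x4) $$ (i, j)"
    using less_3_cases[OF ij(1)] less_3_cases[OF ij(2)] x d
    by (auto simp: kos_mat_tetra_def kos_self[of _ m] kos_cnj[of _ m])
qed (simp_all add: kos_mat_tetra_def)

lemma kos_psd:
  assumes x: "x1 \<in> unit_ball m" "x2 \<in> unit_ball m" "x3 \<in> unit_ball m" "x4 \<in> unit_ball m"
    and d: "x1 \<noteq> x2" "x1 \<noteq> x3" "x1 \<noteq> x4"
  shows "psd_mat 3 (kos_mat (kos x1 x2 x3) (kos x1 x2 x4) (kos x1 x3 x4))"
proof -
  define u where "u y = complex_of_real (1 / cvec_norm (ball_invol x1 y)) \<cdot>\<^sub>v ball_invol x1 y" for y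
  have kos_u: "kos x1 y z = u y \<bullet>c u z" for y z
    by (simp add: kos_def u_def)
  have "u y \<in> carrier_vec m" if "y \<in> unit_ball m" for y
    using ball_invol_carrier[OF x(1) unit_ball_carrier[OF that]] by (simp add: u_def)
  moreover have "u y \<bullet>c u y = 1" if "y \<in> unit_ball m" "x1 \<noteq> y" for y
    using kos_self[OF x(1) that] by (simp add: kos_u)
  ultimately show ?thesis
    unfolding kos_u using x d by (intro kos_mat_psd_gram) auto
qed

subsection \<open>Assembling a tetrahedron\<close>

theorem theorem6p6:
  fixes n2 n3 n4 :: nat
    and t21 t2a t2b t31 t3a t3b t41 t4a t4b :: "complex vec"
    and T2 T3 T4 :: "complex vec list"
    and K23 K24 K34 :: complex
    and M :: "complex mat"
  assumes T2: "T2 = [t21, t2a, t2b]" and tri2: "triangle n2 T2"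
    and T3: "T3 = [t31, t3a, t3b]" and tri3: "triangle n3 T3"
    and T4: "T4 = [t41, t4a, t4b]" and tri4: "triangle n4 T4"
    and match23: "pseudohyp_dist t21 t2b = pseudohyp_dist t31 t3a"
    and match34: "pseudohyp_dist t31 t3b = pseudohyp_dist t41 t4a"
    and match42: "pseudohyp_dist t41 t4b = pseudohyp_dist t21 t2a"
    and K23: "K23 = kos t21 t2a t2b"
    and K34: "K34 = kos t31 t3a t3b"
    and K24: "K24 = cnj (kos t41 t4a t4b)"
    and M: "M = kos_mat K23 K24 K34"
  shows "(\<forall>m X. tetrahedron m X \<and> assembles n2 T2 n3 T3 n4 T4 m X \<longrightarrow>
             M = kos_mat_tetra X \<and> psd_mat 3 M)
       \<and> (psd_mat 3 M \<longrightarrow>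
             (\<exists>m X. tetrahedron m X \<and> assembles n2 T2 n3 T3 n4 T4 m X \<and> M = kos_mat_tetra X))
       \<and> (psd_mat 3 M \<longleftrightarrow> 0 \<le> Determinant.det M)
       \<and> (psd_mat 3 M \<longleftrightarrow>
             0 \<le> 1 + 2 * Re (K23 * cnj K24 * K34)
                 - (cmod K23)\<^sup>2 - (cmod K24)\<^sup>2 - (cmod K34)\<^sup>2)
       \<and> (psd_mat 3 M \<longleftrightarrow>
             (cmod (K34 - cnj K23 * K24))\<^sup>2 \<le> (1 - (cmod K23)\<^sup>2) * (1 - (cmod K24)\<^sup>2))"
proof -
  have mem: "t21 \<in> unit_ball n2" "t2a \<in> unit_ball n2" "t2b \<in> unit_ball n2"
    "t31 \<in> unit_ball n3" "t3a \<in> unit_ball n3" "t3b \<in> unit_ball n3"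
    "t41 \<in> unit_ball n4" "t4a \<in> unit_ball n4" "t4b \<in> unit_ball n4"
    and ne: "t21 \<noteq> t2a" "t21 \<noteq> t2b" "t31 \<noteq> t3b"
    using tri2 tri3 tri4 by (auto simp: triangle_def point_tuple_def T2 T3 T4)
  have le: "cmod K23 \<le> 1" "cmod K24 \<le> 1"
    using kos_norm_le_1 mem by (auto simp: K23 K24)
  have M_eq: "M = kos_mat_tetra X \<and> psd_mat 3 M"
    if X: "tetrahedron m X" and A: "assembles n2 T2 n3 T3 n4 T4 m X" for m X
  proof -
    have "length X = 4" using X by (simp add: tetrahedron_def)
    then obtain x1 x2 x3 x4 where X_eq: "X = [x1, x2, x3, x4]"
      by (auto simp: numeral_eq_Suc length_Suc_conv)
    have x: "x1 \<in> unit_ball m" "x2 \<in> unit_ball m" "x3 \<in> unit_ball m" "x4 \<in> unit_ball m"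
      and d: "x1 \<noteq> x2" "x1 \<noteq> x3" "x1 \<noteq> x4"
      using X by (auto simp: X_eq tetrahedron_def point_tuple_def)
    have "congruent n2 [t21, t2a, t2b] m [x1, x2, x3]"
      "congruent n3 [t31, t3a, t3b] m [x1, x3, x4]" "congruent n4 [t41, t4a, t4b] m [x1, x4, x2]"
      using A by (auto simp: assembles_def X_eq T2 T3 T4 numeral_eq_Suc)
    then have "K23 = kos x1 x2 x3" "K34 = kos x1 x3 x4" "kos t41 t4a t4b = kos x1 x4 x2"
      unfolding K23 K34 using mem x by (auto intro: congruent_kos)
    \<comment> \<open>The third face runs through \<open>x4\<close> before \<open>x2\<close>, so its
      \<open>kos\<close> is the entry below the diagonal; hence the conjugate in
      \<open>K24\<close>.\<close>
    moreover from this(3) have "K24 = kos x1 x2 x4"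
      using kos_cnj[OF x(1,4,2)] by (simp add: K24)
    ultimately have "M = kos_mat (kos x1 x2 x3) (kos x1 x2 x4) (kos x1 x3 x4)"
      by (simp add: M)
    then show ?thesis
      using kos_mat_tetra_eq[OF x d] kos_psd[OF x d] by (simp add: X_eq)
  qed
  have iff: "psd_mat 3 M \<longleftrightarrow>
      (cmod (K34 - cnj K23 * K24))\<^sup>2 \<le> (1 - (cmod K23)\<^sup>2) * (1 - (cmod K24)\<^sup>2)"
    unfolding M by (rule kos_mat_psd_iff[OF le])
  have ex: "\<exists>m X. tetrahedron m X \<and> assembles n2 T2 n3 T3 n4 T4 m X" if psd: "psd_mat 3 M"
  proof -
    obtain u v w where car: "u \<in> carrier_vec 3" "v \<in> carrier_vec 3" "w \<in> carrier_vec 3"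
      and self: "u \<bullet>c u = 1" "v \<bullet>c v = 1" "w \<bullet>c w = 1"
      and cip: "u \<bullet>c v = K23" "u \<bullet>c w = K24" "v \<bullet>c w = K34"
      using gram_vectors_exist[OF le iff[THEN iffD1, OF psd]] by blast
    have unit: "cvec_norm u = 1" "cvec_norm v = 1" "cvec_norm w = 1"
      by (simp_all add: cvec_norm_def self)
    have wu: "w \<bullet>c u = kos t41 t4a t4b"
      using cnj_cip[of u w] car cip by (simp add: K24)
    \<comment> \<open>The lengths of the edges from \<open>x1\<close> to \<open>x2\<close>,
      \<open>x3\<close>, \<open>x4\<close>. Each edge belongs to two faces, and the matching
      conditions make the two prescriptions agree.\<close>
    define d where "d = pseudohyp_dist t21 t2a"
    define e where "e = pseudohyp_dist t21 t2b"
    define f where "f = pseudohyp_dist t31 t3b"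
    have bounds: "0 < d" "d < 1" "0 < e" "e < 1" "0 < f" "f < 1"
      unfolding d_def e_def f_def using mem ne pseudohyp_dist_pos pseudohyp_dist_less_1 by blast+
    define x1 x2 x3 x4 where "x1 = (0\<^sub>v 3 :: complex vec)" and "x2 = complex_of_real d \<cdot>\<^sub>v u"
      and "x3 = complex_of_real e \<cdot>\<^sub>v v" and "x4 = complex_of_real f \<cdot>\<^sub>v w"
    have x: "x1 \<in> unit_ball 3" "x2 \<in> unit_ball 3" "x3 \<in> unit_ball 3" "x4 \<in> unit_ball 3"
      using car unit bounds by (auto simp: x1_def x2_def x3_def x4_def unit_ball_iff)
    have dist: "pseudohyp_dist x1 x2 = d" "pseudohyp_dist x1 x3 = e" "pseudohyp_dist x1 x4 = f"
      unfolding x1_def x2_def x3_def x4_def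
      using zero_vertex(1)[OF car(1) unit(1) car(1) unit(1)] zero_vertex(1)[OF car(2) unit(2) car(2) unit(2)]
        zero_vertex(1)[OF car(3) unit(3) car(3) unit(3)] bounds by blast+
    have kos: "kos x1 x2 x3 = K23" "kos x1 x3 x4 = K34" "kos x1 x4 x2 = kos t41 t4a t4b"
      unfolding x1_def x2_def x3_def x4_def
      using zero_vertex(2)[OF car(1) unit(1) car(2) unit(2)] zero_vertex(2)[OF car(2) unit(2) car(3) unit(3)]
        zero_vertex(2)[OF car(3) unit(3) car(1) unit(1)] bounds cip wu by auto
    have cong: "congruent n2 [t21, t2a, t2b] 3 [x1, x2, x3]"
      "congruent n3 [t31, t3a, t3b] 3 [x1, x3, x4]" "congruent n4 [t41, t4a, t4b] 3 [x1, x4, x2]"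
      by (intro congruentI mem x; simp add: dist kos K23 K34 d_def e_def f_def match23 match34 match42)+
    \<comment> \<open>The vectors \<open>u\<close>, \<open>v\<close>, \<open>w\<close> may coincide:
      \<open>K23 = 1\<close> forces \<open>u = v\<close>. Congruence carries over the distinctness
      of the given triangles, and each pair of vertices lies in one of the three faces.\<close>
    have "distinct [x1, x2, x3]" "distinct [x1, x3, x4]" "distinct [x1, x4, x2]"
      using congruent_distinct[OF cong(1)] congruent_distinct[OF cong(2)] congruent_distinct[OF cong(3)]
        tri2 tri3 tri4 unfolding triangle_def point_tuple_def T2 T3 T4 by blast+
    then have "tetrahedron 3 [x1, x2, x3, x4]"
      using x by (auto simp: tetrahedron_def point_tuple_def)
    moreover have "assembles n2 T2 n3 T3 n4 T4 3 [x1, x2, x3, x4]"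
      using cong by (simp add: assembles_def T2 T3 T4 numeral_eq_Suc)
    ultimately show ?thesis by blast
  qed
  have schur: "(cmod (K34 - cnj K23 * K24))\<^sup>2 \<le> (1 - (cmod K23)\<^sup>2) * (1 - (cmod K24)\<^sup>2) \<longleftrightarrow>
      0 \<le> 1 + 2 * Re (K23 * cnj K24 * K34) - (cmod K23)\<^sup>2 - (cmod K24)\<^sup>2 - (cmod K34)\<^sup>2"
    unfolding kos_mat_schur_complement[symmetric] by simp
  \<comment> \<open>The left inequality is in the order on complex numbers, which also demands equal
    imaginary parts; \<open>kos_mat_det\<close> shows the determinant to be real.\<close>
  have det: "0 \<le> Determinant.det M \<longleftrightarrow>
      0 \<le> 1 + 2 * Re (K23 * cnj K24 * K34) - (cmod K23)\<^sup>2 - (cmod K24)\<^sup>2 - (cmod K34)\<^sup>2"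
    unfolding M kos_mat_det less_eq_complex_def Re_complex_of_real Im_complex_of_real zero_complex.simps
    by simp
  show ?thesis
    using M_eq ex iff schur det by meson
qed

end
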